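(* Let $X$ be an oriented (multi)graph, $k$ a field, $<$ a monomial order on $C(X)$, and $S\subset kC(X)$ a nonempty set of monic polynomials. Let $Id(S)$ be the ideal of the free category partial algebra $kC(X)$ generated by $S$. Then the following statements are equivalent: (i) $S$ is a Gröbner–Shirshov basis in $kC(X)$. (ii) For every nonzero $f\in Id(S)$, $\bar f=a\bar s b$ for some $s\in S$ and $a,b\in C(X)$. (ii)$'$ Every $f\in Id(S)$ can be written as a finite sum $f=\alpha_1a_1s_1b_1+\alpha_2a_2s_2b_2+\cdots$, where each $\alpha_i\in k$, $a_i,b_i\in C(X)$, $s_i\in S$, each $a_is_ib_i$ is an $S$-word, and $a_1\bar s_1b_1>a_2\bar s_2b_2>\cdots$. (iii) $Irr(S)=\{u\in C(X)\mid u\neq a\bar s b \text{ for all } a,b\in C(X),\ s\in S\}$ is a linear basis of the partial algebra $kC(X)/Id(S)=kC(X|S)$.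
   Context: Let $X=(V(X),E(X))$ be an oriented (multi)graph. $C(X)$ denotes the free category on $X$; its objects are the vertices and its morphisms are all paths ("words") in $X$, including the empty paths $1_v$, $v\in V(X)$. We also write $C(X)$ for the set of all its morphisms. Products are defined only for composable paths; whenever a product is written it is assumed to be defined. The length $|u|$ is the number of edges in $u$. The free category partial algebra $kC(X)$ over the field $k$ consists of all finite linear combinations $\sum\alpha_iu_i$ ($\alpha_i\in k$) of words $u_i\in C(X)$ all having the same domain and the same codomain (so each element lies in the $k$-span of some $\mathrm{Hom}(v,w)$). Sums are defined only for elements with the same domain and the same codomain; multiplication is the linear extension of composition. A monomial order on $C(X)$ is a well ordering $>$ on the set of words such that $u>v$ implies $uw>vw$ and $wu>wv$ for all $u,v,w\in C(X)$ for which the products are defined. For nonzero $f\in kC(X)$, $\bar f$ is the largest word occurring in $f$ with nonzero coefficient; $f$ is monic if that coefficient is $1$. For a set $S$ of monic polynomials, an $S$-word is a (defined) product $asb$ with $a,b\in C(X)$, $s\in S$; one has $\overline{asb}=a\bar sb$. The ideal $Id(S)$ generated by $S$ is the set of all finite linear combinations of $S$-words with common domain and common codomain. Compositions of monic $f,g\in kC(X)$: if $w=\bar f=a\bar gb$ with $w,a,b\in C(X)$, the composition of inclusion is $(f,g)_w=f-agb$; if $w=\bar fb=a\bar g$ with $w,a,b\in C(X)$, the composition of intersection is $(f,g)_w=fb-ag$. For $p,q\in kC(X)$, $p\equiv q \bmod (S,w)$ means $p-q=\sum\alpha_ia_is_ib_i$ (finite sum) with $\alpha_i\in k$, $a_i,b_i\in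 C(X)$, $s_i\in S$, $a_is_ib_i$ an $S$-word and $a_i\bar s_ib_i<w$. $S$ is a Gröbner–Shirshov basis in $kC(X)$ if every composition $(f,g)_w$ with $f,g\in S$ satisfies $(f,g)_w\equiv 0\bmod (S,w)$. "Linear basis of the partial algebra $kC(X)/Id(S)$" means: for every pair of objects $v,w$, the images of the elements of $Irr(S)$ with domain $v$ and codomain $w$ form a $k$-basis (indexed by these elements) of the quotient of the $k$-span of $\mathrm{Hom}_{C(X)}(v,w)$ by its intersection with $Id(S)$. *)

theory Defs
  imports
    "HOL-Library.Poly_Mapping"
    "HOL-Algebra.AbelCoset"
    "Graph_Theory.Arc_Walk"
    "Jordan_Normal_Form.VS_Connect"
begin

section \<open>The free category on a directed multigraph\<close>

text \<open>
  A morphism of the free category is a path \<open>(u, p, v)\<close>: its domain \<open>u\<close>, its list of arcs \<open>p\<close>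
  and its codomain \<open>v\<close>. Keeping the end points distinguishes the identities \<open>(v, [], v)\<close>.
  Composition is written in diagrammatic order, so a product \<open>u w\<close> of words is
  the concatenation of paths and is defined if the codomain of \<open>u\<close> is the domain of \<open>w\<close>.
\<close>

type_synonym ('a, 'b) word = "'a \<times> 'b list \<times> 'a"

definition src :: "('a, 'b) word \<Rightarrow> 'a" where
  "src u = fst u"

definition tgt :: "('a, 'b) word \<Rightarrow> 'a" where
  "tgt u = snd (snd u)"

definition path_arcs :: "('a, 'b) word \<Rightarrow> 'b list" where
  "path_arcs u = fst (snd u)"

definition words :: "('a, 'b) pre_digraph \<Rightarrow> ('a, 'b) word set" where
  "words X = {(u, p, v). pre_digraph.awalk X u p v}"

definition hom_set :: "('a, 'b) pre_digraph \<Rightarrow> 'a \<Rightarrow> 'a \<Rightarrow> ('a, 'b) word set" where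
  "hom_set X x y = {u \<in> words X. src u = x \<and> tgt u = y}"

text \<open>The operation \<open>wcomp\<close> is total; it is the product only when \<open>composable u v\<close> holds.\<close>

definition composable :: "('a, 'b) word \<Rightarrow> ('a, 'b) word \<Rightarrow> bool" where
  "composable u v \<longleftrightarrow> tgt u = src v"

definition wcomp :: "('a, 'b) word \<Rightarrow> ('a, 'b) word \<Rightarrow> ('a, 'b) word"  (infixl "\<bullet>\<^sub>w" 70) where
  "u \<bullet>\<^sub>w v = (src u, path_arcs u @ path_arcs v, tgt v)"

text \<open>
  An order is given by its reflexive relation \<open>r\<close>, with \<open>(v, u) \<in> r\<close> meaning \<open>v \<le> u\<close>.
\<close>

definition wless :: "('a, 'b) word rel \<Rightarrow> ('a, 'b) word \<Rightarrow> ('a, 'b) word \<Rightarrow> bool" where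
  "wless r v u \<longleftrightarrow> (v, u) \<in> r \<and> v \<noteq> u"

definition monomial_order :: "('a, 'b) pre_digraph \<Rightarrow> ('a, 'b) word rel \<Rightarrow> bool" where
  "monomial_order X r \<longleftrightarrow> well_order_on (words X) r \<and>
     (\<forall>u\<in>words X. \<forall>v\<in>words X. \<forall>w\<in>words X. wless r v u \<longrightarrow>
        (composable u w \<and> composable v w \<longrightarrow> wless r (v \<bullet>\<^sub>w w) (u \<bullet>\<^sub>w w)) \<and>
        (composable w u \<and> composable w v \<longrightarrow> wless r (w \<bullet>\<^sub>w v) (w \<bullet>\<^sub>w u)))"


section \<open>The free category partial algebra\<close>

text \<open>
  Polynomials are finitely supported functions on words. The partial algebra consists of those
  whose support lies in one hom-set; the zero elements of the different hom-spaces are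
  represented by the same function.
\<close>

type_synonym ('a, 'b, 'k) cpoly = "('a, 'b) word \<Rightarrow>\<^sub>0 'k"

definition hom_space ::
  "('a, 'b) pre_digraph \<Rightarrow> 'a \<Rightarrow> 'a \<Rightarrow> ('a, 'b, 'k::field) cpoly set" where
  "hom_space X x y = {f. Poly_Mapping.keys f \<subseteq> hom_set X x y}"

definition kC :: "('a, 'b) pre_digraph \<Rightarrow> ('a, 'b, 'k::field) cpoly set" where
  "kC X = (\<Union>x\<in>verts X. \<Union>y\<in>verts X. hom_space X x y)"

definition pscale :: "'k \<Rightarrow> ('a, 'b, 'k::field) cpoly \<Rightarrow> ('a, 'b, 'k) cpoly" where
  "pscale c f = Poly_Mapping.map ((*) c) f"

definition pword :: "('a, 'b) word \<Rightarrow> ('a, 'b, 'k::field) cpoly" where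
  "pword u = Poly_Mapping.single u 1"

text \<open>
  The linear extension of \<open>wcomp\<close>, to be used only for factors in
  \<open>hom_space X x y\<close> and \<open>hom_space X y z\<close>.
\<close>

definition pmult ::
  "('a, 'b, 'k::field) cpoly \<Rightarrow> ('a, 'b, 'k) cpoly \<Rightarrow> ('a, 'b, 'k) cpoly"  (infixl "\<bullet>\<^sub>p" 70) where
  "f \<bullet>\<^sub>p g = (\<Sum>u\<in>Poly_Mapping.keys f. \<Sum>v\<in>Poly_Mapping.keys g.
     Poly_Mapping.single (u \<bullet>\<^sub>w v) (Poly_Mapping.lookup f u * Poly_Mapping.lookup g v))"

definition lead :: "('a, 'b) word rel \<Rightarrow> ('a, 'b, 'k::field) cpoly \<Rightarrow> ('a, 'b) word" where
  "lead r f = (THE u. u \<in> Poly_Mapping.keys f \<and> (\<forall>v\<in>Poly_Mapping.keys f. (v, u) \<in> r))"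

definition is_monic :: "('a, 'b) word rel \<Rightarrow> ('a, 'b, 'k::field) cpoly \<Rightarrow> bool" where
  "is_monic r f \<longleftrightarrow> f \<noteq> 0 \<and> Poly_Mapping.lookup f (lead r f) = 1"


section \<open>\<open>S\<close>-words, ideals and compositions\<close>

text \<open>
  An \<open>S\<close>-word \<open>a s b\<close> is recorded by its factors \<open>(a, s, b)\<close>; its value is
  \<open>pword a \<bullet>\<^sub>p s \<bullet>\<^sub>p pword b\<close>, an element of \<open>hom_space X x y\<close>.
\<close>

definition S_words :: "('a, 'b) pre_digraph \<Rightarrow> ('a, 'b, 'k::field) cpoly set \<Rightarrow> 'a \<Rightarrow> 'a \<Rightarrow>
    (('a, 'b) word \<times> ('a, 'b, 'k) cpoly \<times> ('a, 'b) word) set" where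
  "S_words X S x y = {(a, s, b). a \<in> words X \<and> s \<in> S \<and> b \<in> words X \<and>
     s \<in> hom_space X (tgt a) (src b) \<and> src a = x \<and> tgt b = y}"

text \<open>Formal linear combinations of \<open>S\<close>-words with common domain and codomain, and their values.\<close>

type_synonym ('a, 'b, 'k) S_term = "'k \<times> ('a, 'b) word \<times> ('a, 'b, 'k) cpoly \<times> ('a, 'b) word"

definition S_combs :: "('a, 'b) pre_digraph \<Rightarrow> ('a, 'b, 'k::field) cpoly set \<Rightarrow>
    ('a, 'b, 'k) S_term list set" where
  "S_combs X S = {ts. \<exists>x\<in>verts X. \<exists>y\<in>verts X. \<forall>(\<alpha>, a, s, b)\<in>set ts. (a, s, b) \<in> S_words X S x y}"

definition comb_value :: "('a, 'b, 'k::field) S_term list \<Rightarrow> ('a, 'b, 'k) cpoly" where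
  "comb_value ts = (\<Sum>(\<alpha>, a, s, b)\<leftarrow>ts. pscale \<alpha> (pword a \<bullet>\<^sub>p s \<bullet>\<^sub>p pword b))"

definition term_lead :: "('a, 'b) word rel \<Rightarrow> ('a, 'b, 'k::field) S_term \<Rightarrow> ('a, 'b) word" where
  "term_lead r t = (case t of (\<alpha>, a, s, b) \<Rightarrow> a \<bullet>\<^sub>w lead r s \<bullet>\<^sub>w b)"

definition Id_gen :: "('a, 'b) pre_digraph \<Rightarrow> ('a, 'b, 'k::field) cpoly set \<Rightarrow>
    ('a, 'b, 'k) cpoly set" where
  "Id_gen X S = comb_value ` S_combs X S"

text \<open>The pairs \<open>(w, (f, g)\<^sub>w)\<close> for the compositions of inclusion and of intersection.\<close>

definition inclusion_comps :: "('a, 'b) pre_digraph \<Rightarrow> ('a, 'b) word rel \<Rightarrow>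
    ('a, 'b, 'k::field) cpoly \<Rightarrow> ('a, 'b, 'k) cpoly \<Rightarrow>
    (('a, 'b) word \<times> ('a, 'b, 'k) cpoly) set" where
  "inclusion_comps X r f g = {(w, f - pword a \<bullet>\<^sub>p g \<bullet>\<^sub>p pword b) | w a b.
     w \<in> words X \<and> a \<in> words X \<and> b \<in> words X \<and>
     composable a (lead r g) \<and> composable (lead r g) b \<and>
     w = lead r f \<and> w = a \<bullet>\<^sub>w lead r g \<bullet>\<^sub>w b}"

definition intersection_comps :: "('a, 'b) pre_digraph \<Rightarrow> ('a, 'b) word rel \<Rightarrow>
    ('a, 'b, 'k::field) cpoly \<Rightarrow> ('a, 'b, 'k) cpoly \<Rightarrow>
    (('a, 'b) word \<times> ('a, 'b, 'k) cpoly) set" where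
  "intersection_comps X r f g = {(w, f \<bullet>\<^sub>p pword b - pword a \<bullet>\<^sub>p g) | w a b.
     w \<in> words X \<and> a \<in> words X \<and> b \<in> words X \<and>
     composable (lead r f) b \<and> composable a (lead r g) \<and>
     w = lead r f \<bullet>\<^sub>w b \<and> w = a \<bullet>\<^sub>w lead r g}"

definition equiv_mod :: "('a, 'b) pre_digraph \<Rightarrow> ('a, 'b) word rel \<Rightarrow>
    ('a, 'b, 'k::field) cpoly set \<Rightarrow> ('a, 'b) word \<Rightarrow>
    ('a, 'b, 'k) cpoly \<Rightarrow> ('a, 'b, 'k) cpoly \<Rightarrow> bool" where
  "equiv_mod X r S w p q \<longleftrightarrow>
     (\<exists>ts\<in>S_combs X S. p - q = comb_value ts \<and> (\<forall>t\<in>set ts. wless r (term_lead r t) w))"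

definition GS_basis :: "('a, 'b) pre_digraph \<Rightarrow> ('a, 'b) word rel \<Rightarrow>
    ('a, 'b, 'k::field) cpoly set \<Rightarrow> bool" where
  "GS_basis X r S \<longleftrightarrow> (\<forall>f\<in>S. \<forall>g\<in>S.
     \<forall>(w, h) \<in> inclusion_comps X r f g \<union> intersection_comps X r f g. equiv_mod X r S w h 0)"

definition Irr :: "('a, 'b) pre_digraph \<Rightarrow> ('a, 'b) word rel \<Rightarrow>
    ('a, 'b, 'k::field) cpoly set \<Rightarrow> ('a, 'b) word set" where
  "Irr X r S = {u \<in> words X. \<forall>a\<in>words X. \<forall>b\<in>words X. \<forall>s\<in>S.
     composable a (lead r s) \<and> composable (lead r s) b \<longrightarrow> u \<noteq> a \<bullet>\<^sub>w lead r s \<bullet>\<^sub>w b}"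


section \<open>The hom-spaces of the quotient\<close>

text \<open>
  The record type of modules extends that of rings; the fields \<open>mult\<close> and \<open>one\<close>
  play no role in a module.
\<close>

definition hom_module :: "('a, 'b) pre_digraph \<Rightarrow> 'a \<Rightarrow> 'a \<Rightarrow>
    ('k::field, ('a, 'b, 'k) cpoly) module" where
  "hom_module X x y = \<lparr>carrier = hom_space X x y, mult = undefined, one = undefined,
     zero = 0, add = (+), smult = pscale\<rparr>"

definition quot_module :: "('k, 'm) module \<Rightarrow> 'm set \<Rightarrow> ('k, 'm set) module" where
  "quot_module M N = \<lparr>carrier = a_rcosets\<^bsub>M\<^esub> N, mult = undefined, one = undefined,
     zero = N, add = set_add M, smult = (\<lambda>c A. \<Union>f\<in>A. N +>\<^bsub>M\<^esub> (c \<odot>\<^bsub>M\<^esub> f))\<rparr>"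

definition hom_ideal :: "('a, 'b) pre_digraph \<Rightarrow> ('a, 'b, 'k::field) cpoly set \<Rightarrow>
    'a \<Rightarrow> 'a \<Rightarrow> ('a, 'b, 'k) cpoly set" where
  "hom_ideal X S x y = Id_gen X S \<inter> hom_space X x y"

definition quot_hom :: "('a, 'b) pre_digraph \<Rightarrow> ('a, 'b, 'k::field) cpoly set \<Rightarrow>
    'a \<Rightarrow> 'a \<Rightarrow> ('k, ('a, 'b, 'k) cpoly set) module" where
  "quot_hom X S x y = quot_module (hom_module X x y) (hom_ideal X S x y)"

definition quot_class :: "('a, 'b) pre_digraph \<Rightarrow> ('a, 'b, 'k::field) cpoly set \<Rightarrow>
    'a \<Rightarrow> 'a \<Rightarrow> ('a, 'b) word \<Rightarrow> ('a, 'b, 'k) cpoly set" where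
  "quot_class X S x y u = hom_ideal X S x y +>\<^bsub>hom_module X x y\<^esub> pword u"

definition linear_basis :: "('a, 'b) pre_digraph \<Rightarrow> ('a, 'b, 'k::field) cpoly set \<Rightarrow>
    ('a, 'b) word set \<Rightarrow> bool" where
  "linear_basis X S B \<longleftrightarrow> (\<forall>x\<in>verts X. \<forall>y\<in>verts X.
     inj_on (quot_class X S x y) (B \<inter> hom_set X x y) \<and>
     vectorspace.basis class_ring (quot_hom X S x y)
       (quot_class X S x y ` (B \<inter> hom_set X x y)))"


section \<open>The quotient hom-spaces are vector spaces\<close>

lemma lookup_pscale [simp]: "Poly_Mapping.lookup (pscale c f) u = c * Poly_Mapping.lookup f u"
  unfolding pscale_def by (simp add: Poly_Mapping.map.rep_eq when_def)

lemma pscale_simps: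
  "pscale c (f + g) = pscale c f + pscale c g" "pscale (c + d) f = pscale c f + pscale d f"
  "pscale (c * d) f = pscale c (pscale d f)" "pscale 1 f = f" "pscale c 0 = 0"
  "pscale c (f - g) = pscale c f - pscale c g" "pscale (- 1) f = - f"
  by (auto intro!: poly_mapping_eqI simp: lookup_add lookup_minus algebra_simps)

lemma hom_space_iff: "f \<in> hom_space X x y \<longleftrightarrow> (\<forall>u. u \<notin> hom_set X x y \<longrightarrow> Poly_Mapping.lookup f u = 0)"
  by (auto simp: hom_space_def in_keys_iff)

lemma hom_space_closed:
  "0 \<in> hom_space X x y"
  "f \<in> hom_space X x y \<Longrightarrow> g \<in> hom_space X x y \<Longrightarrow> f + g \<in> hom_space X x y"
  "f \<in> hom_space X x y \<Longrightarrow> g \<in> hom_space X x y \<Longrightarrow> f - g \<in> hom_space X x y"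
  "f \<in> hom_space X x y \<Longrightarrow> - f \<in> hom_space X x y"
  "f \<in> hom_space X x y \<Longrightarrow> pscale c f \<in> hom_space X x y"
  by (auto simp: hom_space_iff lookup_add lookup_minus)

lemma hom_space_sum: "(\<And>i. i \<in> I \<Longrightarrow> f i \<in> hom_space X x y) \<Longrightarrow> sum f I \<in> hom_space X x y"
  by (induction I rule: infinite_finite_induct) (auto intro: hom_space_closed)

lemma wcomp_hom_set:
  assumes "wf_digraph X" "u \<in> hom_set X x y" "v \<in> hom_set X y z"
  shows "u \<bullet>\<^sub>w v \<in> hom_set X x z"
proof -
  interpret wf_digraph X by fact
  obtain p q where "u = (x, p, y)" "v = (y, q, z)" "awalk x p y" "awalk y q z"
    using assms by (auto simp: hom_set_def words_def src_def tgt_def)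
  then show ?thesis
    by (auto simp: hom_set_def words_def src_def tgt_def wcomp_def path_arcs_def)
qed

lemma pmult_hom_space:
  assumes "wf_digraph X" "f \<in> hom_space X x y" "g \<in> hom_space X y z"
  shows "f \<bullet>\<^sub>p g \<in> hom_space X x z"
  unfolding pmult_def
proof (intro hom_space_sum)
  fix u v assume "u \<in> Poly_Mapping.keys f" "v \<in> Poly_Mapping.keys g"
  then have "u \<bullet>\<^sub>w v \<in> hom_set X x z"
    using assms by (intro wcomp_hom_set[where y = y]) (auto simp: hom_space_def)
  then show "Poly_Mapping.single (u \<bullet>\<^sub>w v)
     (Poly_Mapping.lookup f u * Poly_Mapping.lookup g v) \<in> hom_space X x z"
    by (auto simp: hom_space_def)
qed

lemma pword_hom_space: "u \<in> words X \<Longrightarrow> pword u \<in> hom_space X (src u) (tgt u)"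
  by (auto simp: hom_space_def pword_def hom_set_def)

lemma comb_value_hom_space:
  assumes "wf_digraph X" "\<forall>(\<alpha>, a, s, b)\<in>set ts. (a, s, b) \<in> S_words X S x y"
  shows "comb_value ts \<in> hom_space X x y"
  using assms(2)
proof (induction ts)
  case Nil
  then show ?case by (simp add: comb_value_def hom_space_closed)
next
  case (Cons t ts)
  obtain \<alpha> a s b where t: "t = (\<alpha>, a, s, b)" by (cases t)
  have "pword a \<bullet>\<^sub>p s \<bullet>\<^sub>p pword b \<in> hom_space X x y"
    using Cons.prems assms(1) unfolding t S_words_def
    by (auto intro!: pmult_hom_space pword_hom_space simp del: split_paired_All)
  then show ?case
    using Cons by (auto simp: comb_value_def t intro!: hom_space_closed)
qed

lemma Id_gen_hom_iff:
  assumes "wf_digraph X" "x \<in> verts X" "y \<in> verts X"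
  shows "f \<in> hom_ideal X S x y \<longleftrightarrow>
    (\<exists>ts. (\<forall>(\<alpha>, a, s, b)\<in>set ts. (a, s, b) \<in> S_words X S x y) \<and> f = comb_value ts)"
    (is "_ \<longleftrightarrow> ?R")
proof
  assume "f \<in> hom_ideal X S x y"
  then obtain x' y' ts where *: "\<forall>(\<alpha>, a, s, b)\<in>set ts. (a, s, b) \<in> S_words X S x' y'"
      "f = comb_value ts" "f \<in> hom_space X x y"
    by (auto simp: hom_ideal_def Id_gen_def S_combs_def)
  have 2: "f \<in> hom_space X x' y'" using * comb_value_hom_space[OF assms(1)] by blast
  show ?R
  proof (cases "x' = x \<and> y' = y")
    case False
    have "f = 0"
    proof (rule poly_mapping_eqI)
      fix u
      have "u \<notin> hom_set X x y \<or> u \<notin> hom_set X x' y'" using False by (auto simp: hom_set_def)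
      then show "Poly_Mapping.lookup f u = Poly_Mapping.lookup 0 u"
        using 2 *(3) unfolding hom_space_iff by (metis lookup_zero)
    qed
    then show ?thesis by (intro exI[of _ "[]"]) (simp add: comb_value_def)
  qed (use * in blast)
next
  assume ?R
  then show "f \<in> hom_ideal X S x y"
    using assms comb_value_hom_space[OF assms(1), of _ S x y]
    unfolding hom_ideal_def Id_gen_def S_combs_def by blast
qed

lemma hom_ideal_closed:
  assumes "wf_digraph X" "x \<in> verts X" "y \<in> verts X"
  shows "0 \<in> hom_ideal X S x y"
    and "f \<in> hom_ideal X S x y \<Longrightarrow> g \<in> hom_ideal X S x y \<Longrightarrow> f + g \<in> hom_ideal X S x y"
    and "f \<in> hom_ideal X S x y \<Longrightarrow> pscale c f \<in> hom_ideal X S x y"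
proof -
  note iff = Id_gen_hom_iff[OF assms]
  show "0 \<in> hom_ideal X S x y"
    unfolding iff by (intro exI[of _ "[]"]) (simp add: comb_value_def)
  show "f + g \<in> hom_ideal X S x y" if "f \<in> hom_ideal X S x y" "g \<in> hom_ideal X S x y"
  proof -
    from that obtain ts us where "\<forall>(\<alpha>, a, s, b)\<in>set ts. (a, s, b) \<in> S_words X S x y"
      "f = comb_value ts" "\<forall>(\<alpha>, a, s, b)\<in>set us. (a, s, b) \<in> S_words X S x y" "g = comb_value us"
      unfolding iff by blast
    then show ?thesis
      unfolding iff by (intro exI[of _ "ts @ us"]) (auto simp: comb_value_def)
  qed
  show "pscale c f \<in> hom_ideal X S x y" if "f \<in> hom_ideal X S x y"
  proof -
    from that obtain ts where ts: "\<forall>(\<alpha>, a, s, b)\<in>set ts. (a, s, b) \<in> S_words X S x y"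
      "f = comb_value ts" unfolding iff by blast
    have "pscale c (comb_value ts) = comb_value (map (\<lambda>(\<alpha>, t). (c * \<alpha>, t)) ts)"
      by (induction ts) (auto simp: comb_value_def pscale_simps)
    then show ?thesis
      unfolding iff using ts by (intro exI[of _ "map (\<lambda>(\<alpha>, t). (c * \<alpha>, t)) ts"]) auto
  qed
qed

lemma quot_hom_vectorspace:
  fixes S :: "('a, 'b, 'k::field) cpoly set"
  assumes "wf_digraph X" "x \<in> verts X" "y \<in> verts X"
  shows "vectorspace class_ring (quot_hom X S x y)"
proof -
  define M where "M = (hom_module X x y :: ('k, ('a, 'b, 'k) cpoly) module)"
  define N where "N = hom_ideal X S x y"
  have Nsub: "N \<subseteq> hom_space X x y" by (auto simp: N_def hom_ideal_def)
  have N0: "0 \<in> N" and Nadd: "\<And>f g. f \<in> N \<Longrightarrow> g \<in> N \<Longrightarrow> f + g \<in> N"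
    and Nsc: "\<And>c f. f \<in> N \<Longrightarrow> pscale c f \<in> N"
    using hom_ideal_closed[OF assms] by (auto simp: N_def)
  have Nm: "- f \<in> N" if "f \<in> N" for f using Nsc[of f "-1"] that by (simp add: pscale_simps)
  have Nd: "f - g \<in> N" if "f \<in> N" "g \<in> N" for f g using Nadd[OF that(1) Nm[OF that(2)]] by simp
  define cl where "cl f = N +>\<^bsub>M\<^esub> f" for f
  have cl_iff: "h \<in> cl f \<longleftrightarrow> h - f \<in> N" for f h
    unfolding cl_def a_r_coset_def' by (auto simp: M_def hom_module_def intro: bexI[of _ "h - f"])
  have cl_eq: "cl f = cl g \<longleftrightarrow> f - g \<in> N" for f g
  proof
    assume "cl f = cl g" then have "f \<in> cl g" using N0 cl_iff[of f f] by simp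
    then show "f - g \<in> N" by (simp add: cl_iff)
  next
    assume *: "f - g \<in> N"
    show "cl f = cl g"
    proof (rule Set.set_eqI)
      fix h
      show "h \<in> cl f \<longleftrightarrow> h \<in> cl g"
        using Nadd[OF _ *, of "h - f"] Nd[OF _ *, of "h - g"] by (auto simp: cl_iff)
    qed
  qed
  let ?Q = "quot_hom X S x y"
  have Q: "?Q = quot_module M N" by (simp add: quot_hom_def M_def N_def)
  have car: "carrier ?Q = cl ` hom_space X x y"
    unfolding Q quot_module_def A_RCOSETS_def'
    by (auto simp: cl_def M_def hom_module_def)
  have zero: "\<zero>\<^bsub>?Q\<^esub> = cl 0"
    unfolding Q quot_module_def by (auto simp: cl_iff)
  have add: "cl f \<oplus>\<^bsub>?Q\<^esub> cl g = cl (f + g)" for f g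
  proof -
    have "h \<in> cl f \<oplus>\<^bsub>?Q\<^esub> cl g \<longleftrightarrow> (\<exists>f'\<in>cl f. \<exists>g'\<in>cl g. h = f' + g')" for h
      unfolding Q quot_module_def by (simp add: set_add_def set_mult_def M_def hom_module_def)
    moreover have "(\<exists>f'\<in>cl f. \<exists>g'\<in>cl g. h = f' + g') \<longleftrightarrow> h - (f + g) \<in> N" for h
    proof
      assume "\<exists>f'\<in>cl f. \<exists>g'\<in>cl g. h = f' + g'"
      then obtain f' g' where "f' - f \<in> N" "g' - g \<in> N" "h = f' + g'" by (auto simp: cl_iff)
      moreover have "f' + g' - (f + g) = (f' - f) + (g' - g)" by simp
      ultimately show "h - (f + g) \<in> N" using Nadd by metis
    next
      assume "h - (f + g) \<in> N"
      then have "h - g \<in> cl f" "g \<in> cl g" "h = (h - g) + g"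
        using N0 by (auto simp: cl_iff algebra_simps)
      then show "\<exists>f'\<in>cl f. \<exists>g'\<in>cl g. h = f' + g'" by blast
    qed
    ultimately show ?thesis by (auto simp: cl_iff)
  qed
  have smult: "c \<odot>\<^bsub>?Q\<^esub> cl f = cl (pscale c f)" for c f
  proof -
    have "c \<odot>\<^bsub>?Q\<^esub> cl f = (\<Union>g\<in>cl f. cl (pscale c g))"
      unfolding Q quot_module_def by (simp add: cl_def M_def hom_module_def)
    moreover have "cl (pscale c g) = cl (pscale c f)" if "g \<in> cl f" for g
      using Nsc[of "g - f" c] that by (simp add: cl_eq cl_iff pscale_simps)
    moreover have "f \<in> cl f" using N0 by (simp add: cl_iff)
    ultimately show ?thesis by blast
  qed
  have "module class_ring ?Q"
  proof (rule Module.moduleI)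
    show "cring (class_ring :: 'k ring)" by (rule class_cring.is_cring)
    show "abelian_group ?Q"
    proof (rule abelian_groupI)
      fix A assume "A \<in> carrier ?Q"
      then obtain f where f: "A = cl f" "f \<in> hom_space X x y" by (auto simp: car)
      show "\<exists>B\<in>carrier ?Q. B \<oplus>\<^bsub>?Q\<^esub> A = \<zero>\<^bsub>?Q\<^esub>"
        using f by (intro bexI[of _ "cl (- f)"]) (auto simp: car zero add intro: hom_space_closed)
    qed (auto simp: car zero add add_ac intro!: imageI hom_space_closed)
  qed (auto simp: car add smult pscale_simps intro!: imageI hom_space_closed)
  then show ?thesis
    unfolding vectorspace_def using class_field by auto
qed

end

theory Submission
  imports Defs
begin

text \<open>
  Under a Groebner--Shirshov basis, two \<open>S\<close>-words with the same leading word \<open>w\<close> differ by a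
  combination of \<open>S\<close>-words with leading words below \<open>w\<close>: after cancelling common outer factors,
  the difference is a composition of the two relations. Hence the terms with the greatest leading word in a
  combination can be merged into one \<open>S\<close>-word, and well-founded induction shows that the leading
  word of an ideal element is reducible. Conversely, division by \<open>S\<close> writes every polynomial as a
  combination of \<open>S\<close>-words with strictly decreasing leading words plus a remainder supported
  on irreducible words; if leading words of ideal elements are reducible, the remainder of an ideal
  element vanishes. The irreducible words always span the quotient, so they form
  a basis exactly if no nonzero ideal element is supported on them.
\<close>

section \<open>Pushing polynomials forward along maps of words\<close>

text \<open>The linear extension of \<open>\<phi>\<close> to the free vector space on words. Words
  with the same image have their coefficients added, so \<open>\<phi>\<close> may be any
  map.\<close>

definition pushforward ::
  "(('a, 'b) word \<Rightarrow> ('a, 'b) word) \<Rightarrow> ('a, 'b, 'k::field) cpoly \<Rightarrow> ('a, 'b, 'k) cpoly" where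
  "pushforward \<phi> f =
     (\<Sum>u\<in>Poly_Mapping.keys f. Poly_Mapping.single (\<phi> u) (Poly_Mapping.lookup f u))"

text \<open>The supports of \<open>f\<close>, \<open>g\<close> and \<open>f + g\<close> differ in
  general. Summing over one common finite superset makes linearity a termwise computation.\<close>

lemma pushforward_superset:
  assumes "finite A" "Poly_Mapping.keys f \<subseteq> A"
  shows "pushforward \<phi> f = (\<Sum>u\<in>A. Poly_Mapping.single (\<phi> u) (Poly_Mapping.lookup f u))"
  unfolding pushforward_def
  by (rule sum.mono_neutral_left) (use assms in \<open>auto simp: in_keys_iff\<close>)

lemma pushforward_0 [simp]: "pushforward \<phi> 0 = 0"
  by (simp add: pushforward_def)

lemma pushforward_single [simp]:
  "pushforward \<phi> (Poly_Mapping.single u c) = Poly_Mapping.single (\<phi> u) c"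
  by (cases "c = 0") (auto simp: pushforward_def)

lemma pushforward_add: "pushforward \<phi> (f + g) = pushforward \<phi> f + pushforward \<phi> g"
proof -
  let ?A = "Poly_Mapping.keys f \<union> Poly_Mapping.keys g"
  have "Poly_Mapping.keys (f + g) \<subseteq> ?A" by (rule Poly_Mapping.keys_add)
  then show ?thesis
    by (simp add: pushforward_superset[of ?A] lookup_add single_add sum.distrib)
qed

lemma pscale_single [simp]:
  "pscale c (Poly_Mapping.single u d) = Poly_Mapping.single u (c * d)"
  by (rule poly_mapping_eqI) (simp add: lookup_single when_def)

lemma pscale_0 [simp]: "pscale 0 f = 0"
  by (rule poly_mapping_eqI) simp

lemma pscale_sum: "pscale c (sum f A) = (\<Sum>i\<in>A. pscale c (f i))"
  by (induction A rule: infinite_finite_induct) (auto simp: pscale_simps)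

lemma keys_pscale: "Poly_Mapping.keys (pscale c f) \<subseteq> Poly_Mapping.keys f"
  by (auto simp: in_keys_iff)

lemma pushforward_pscale: "pushforward \<phi> (pscale c f) = pscale c (pushforward \<phi> f)"
  by (simp add: pushforward_superset[OF finite_keys keys_pscale, of _ c f]
      pushforward_def[of _ f] pscale_sum)

lemma pushforward_diff: "pushforward \<phi> (f - g) = pushforward \<phi> f - pushforward \<phi> g"
  using pushforward_add[of \<phi> "f - g" g] by simp

lemma pushforward_sum: "pushforward \<phi> (sum f A) = (\<Sum>i\<in>A. pushforward \<phi> (f i))"
  by (induction A rule: infinite_finite_induct) (auto simp: pushforward_add)

lemma pushforward_pushforward:
  "pushforward \<phi> (pushforward \<psi> f) = pushforward (\<lambda>u. \<phi> (\<psi> u)) f"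
proof -
  have "pushforward \<phi> (pushforward \<psi> f) =
      (\<Sum>u\<in>Poly_Mapping.keys f. pushforward \<phi> (Poly_Mapping.single (\<psi> u) (Poly_Mapping.lookup f u)))"
    unfolding pushforward_def[of \<psi>] by (rule pushforward_sum)
  then show ?thesis by (simp add: pushforward_def[of "\<lambda>u. \<phi> (\<psi> u)"])
qed

lemma pushforward_ident:
  assumes "\<And>u. u \<in> Poly_Mapping.keys f \<Longrightarrow> \<phi> u = u"
  shows "pushforward \<phi> f = f"
proof (rule poly_mapping_eqI)
  fix v
  have "Poly_Mapping.lookup (pushforward \<phi> f) v =
      (\<Sum>u\<in>Poly_Mapping.keys f. Poly_Mapping.lookup f u when u = v)"
    using assms by (simp add: pushforward_def lookup_sum lookup_single)
  also have "\<dots> = Poly_Mapping.lookup f v"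
    by (cases "v \<in> Poly_Mapping.keys f") (auto simp: when_def in_keys_iff)
  finally show "Poly_Mapping.lookup (pushforward \<phi> f) v = Poly_Mapping.lookup f v" .
qed

lemma keys_sum_single:
  "Poly_Mapping.keys (\<Sum>u\<in>A. Poly_Mapping.single (\<phi> u) (c u)) \<subseteq> \<phi> ` A"
proof (induction A rule: infinite_finite_induct)
  case (insert u A)
  show ?case
    using insert Poly_Mapping.keys_add[of "Poly_Mapping.single (\<phi> u) (c u)"
        "\<Sum>u\<in>A. Poly_Mapping.single (\<phi> u) (c u)"]
    by (auto split: if_splits)
qed auto

lemma keys_pushforward: "Poly_Mapping.keys (pushforward \<phi> f) \<subseteq> \<phi> ` Poly_Mapping.keys f"
  unfolding pushforward_def by (rule keys_sum_single)

text \<open>Injectivity on the support rules out a merging of coefficients. For products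
  \<open>a s b\<close> this keeps the coefficient of the leading word equal to 1.\<close>

lemma lookup_pushforward:
  assumes "inj_on \<phi> (Poly_Mapping.keys f)" "u \<in> Poly_Mapping.keys f"
  shows "Poly_Mapping.lookup (pushforward \<phi> f) (\<phi> u) = Poly_Mapping.lookup f u"
proof -
  have "Poly_Mapping.lookup (pushforward \<phi> f) (\<phi> u) =
      (\<Sum>v\<in>Poly_Mapping.keys f. Poly_Mapping.lookup f v when \<phi> v = \<phi> u)"
    by (simp add: pushforward_def lookup_sum lookup_single)
  also have "\<dots> = (\<Sum>v\<in>Poly_Mapping.keys f. if v = u then Poly_Mapping.lookup f v else 0)"
    using assms by (intro sum.cong) (auto simp: when_def inj_on_def)
  also have "\<dots> = Poly_Mapping.lookup f u" using assms(2) by simp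
  finally show ?thesis .
qed

lemma sum_single_lookup:
  fixes p :: "('a, 'b, 'k::field) cpoly"
  shows "(\<Sum>u\<in>Poly_Mapping.keys p. Poly_Mapping.single u (Poly_Mapping.lookup p u)) = p"
  using pushforward_ident[of p "\<lambda>u. u"] by (simp add: pushforward_def)

lemma lookup_sum_single:
  "finite A \<Longrightarrow> Poly_Mapping.lookup (\<Sum>u\<in>A. Poly_Mapping.single u (c u)) v = (if v \<in> A then c v else 0)"
  by (simp add: lookup_sum lookup_single when_def)

lemma pmult_pword: "f \<bullet>\<^sub>p pword b = pushforward (\<lambda>u. u \<bullet>\<^sub>w b) f"
  by (simp add: pmult_def pword_def pushforward_def)

lemma pword_pmult: "pword a \<bullet>\<^sub>p f = pushforward (\<lambda>u. a \<bullet>\<^sub>w u) f"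
  by (simp add: pmult_def pword_def pushforward_def)

text \<open>Since \<open>wcomp\<close> is a total operation, multiplication by words on both sides
  is one pushforward. Identities between such products then reduce to identities between maps of
  words.\<close>

lemma pword_pmult_pword:
  "pword a \<bullet>\<^sub>p f \<bullet>\<^sub>p pword b = pushforward (\<lambda>u. a \<bullet>\<^sub>w u \<bullet>\<^sub>w b) f"
  by (simp add: pmult_pword pword_pmult pushforward_pushforward)


section \<open>Words\<close>

lemma src_wcomp [simp]: "src (u \<bullet>\<^sub>w v) = src u"
  and tgt_wcomp [simp]: "tgt (u \<bullet>\<^sub>w v) = tgt v"
  and path_arcs_wcomp [simp]: "path_arcs (u \<bullet>\<^sub>w v) = path_arcs u @ path_arcs v"
  by (simp_all add: wcomp_def src_def tgt_def path_arcs_def)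

lemma word_eq_iff: "u = v \<longleftrightarrow> src u = src v \<and> path_arcs u = path_arcs v \<and> tgt u = tgt v"
  by (auto simp: src_def tgt_def path_arcs_def prod_eq_iff)

lemma wcomp_assoc: "u \<bullet>\<^sub>w v \<bullet>\<^sub>w w = u \<bullet>\<^sub>w (v \<bullet>\<^sub>w w)"
  by (simp add: word_eq_iff)

text \<open>Multiplication by \<open>(x, [], x)\<close> resets the source of every word to
  \<open>x\<close>. It therefore fixes \<open>f\<close> because all words of \<open>f\<close>
  already start at \<open>x\<close>.\<close>

lemma unit_pmult: "f \<in> hom_space X x y \<Longrightarrow> pword (x, [], x) \<bullet>\<^sub>p f = f"
  unfolding pword_pmult
  by (rule pushforward_ident)
    (auto simp: hom_space_def hom_set_def wcomp_def src_def tgt_def path_arcs_def)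

lemma pmult_unit: "f \<in> hom_space X x y \<Longrightarrow> f \<bullet>\<^sub>p pword (y, [], y) = f"
  unfolding pmult_pword
  by (rule pushforward_ident)
    (auto simp: hom_space_def hom_set_def wcomp_def src_def tgt_def path_arcs_def)

lemma append_eq_append_longer:
  assumes "xs @ ys = xs' @ ys'" "length xs \<le> length xs'"
  obtains q where "xs' = xs @ q" "ys = q @ ys'"
  using assms by (auto simp: append_eq_append_conv2)

section \<open>Cancellation of common prefixes and suffixes of paths\<close>

context wf_digraph
begin

lemma words_iff: "u \<in> words G \<longleftrightarrow> awalk (src u) (path_arcs u) (tgt u)"
  by (cases u) (simp add: words_def src_def tgt_def path_arcs_def)

lemma wcomp_words: "u \<in> words G \<Longrightarrow> v \<in> words G \<Longrightarrow> tgt u = src v \<Longrightarrow> u \<bullet>\<^sub>w v \<in> words G"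
  using wcomp_hom_set[OF wf_digraph_axioms, of u "src u" "src v" v "tgt v"]
  by (simp add: hom_set_def)

lemma src_in_verts: "u \<in> words G \<Longrightarrow> src u \<in> verts G"
  and tgt_in_verts: "u \<in> words G \<Longrightarrow> tgt u \<in> verts G"
  by (auto simp: words_iff awalk_hd_in_verts awalk_last_in_verts)

text \<open>Arc lists alone do not record end points, so the cofactor needs an explicit source.
  Splitting the walk \<open>v\<close> after the arcs of \<open>u\<close> shows that it is
  \<open>tgt u\<close>.\<close>

lemma word_cancel_prefix:
  assumes "u \<in> words G" "v \<in> words G" "src u = src v" "path_arcs v = path_arcs u @ q"
  obtains c where "c \<in> words G" "path_arcs c = q" "src c = tgt u" "v = u \<bullet>\<^sub>w c"
proof -
  define c where "c = (tgt u, q, tgt v)"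
  have c: "src c = tgt u" "path_arcs c = q" "tgt c = tgt v"
    by (simp_all add: c_def src_def path_arcs_def tgt_def)
  have "awalk (src v) (path_arcs u) (tgt u)"
    using assms(1,3) by (simp add: words_iff)
  then have "awlast (src v) (path_arcs u) = tgt u" by simp
  then have "c \<in> words G"
    using assms(2,4) by (simp add: words_iff c)
  moreover have "v = u \<bullet>\<^sub>w c" using assms(3,4) by (simp add: word_eq_iff[of v] c)
  ultimately show thesis using that c by blast
qed

lemma word_cancel_suffix:
  assumes "u \<in> words G" "v \<in> words G" "tgt u = tgt v" "path_arcs v = q @ path_arcs u"
  obtains c where "c \<in> words G" "path_arcs c = q" "tgt c = src u" "v = c \<bullet>\<^sub>w u"
proof -
  define z where "z = awlast (src v) q"
  define c where "c = (src v, q, src u)"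
  have c: "src c = src v" "path_arcs c = q" "tgt c = src u"
    by (simp_all add: c_def src_def path_arcs_def tgt_def)
  have *: "awalk (src v) q z" "awalk z (path_arcs u) (tgt v)"
    using assms(2,4) by (auto simp: words_iff z_def)
  \<comment> \<open>A nonempty arc list determines its end points. If \<open>u\<close> has no arcs,
    then \<open>z = tgt v = tgt u = src u\<close>.\<close>
  have "z = src u"
    using awalk_ends[OF *(2), of "src u" "tgt u"] assms(1,3) by (auto simp: words_iff)
  with * have "c \<in> words G" by (simp add: words_iff c)
  moreover have "v = c \<bullet>\<^sub>w u" using assms(3,4) by (simp add: word_eq_iff[of v] c)
  ultimately show thesis using that c by blast
qed

end


section \<open>Leading words\<close>

locale monomial_category = wf_digraph X for X :: "('a, 'b) pre_digraph" +
  fixes r :: "('a, 'b) word rel"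
  assumes monomial: "monomial_order X r"
begin

lemma well_order: "well_order_on (words X) r"
  using monomial by (simp add: monomial_order_def)

lemma order_refl: "u \<in> words X \<Longrightarrow> (u, u) \<in> r"
  and order_trans: "(u, v) \<in> r \<Longrightarrow> (v, w) \<in> r \<Longrightarrow> (u, w) \<in> r"
  and order_antisym: "(u, v) \<in> r \<Longrightarrow> (v, u) \<in> r \<Longrightarrow> u = v"
  and order_total: "u \<in> words X \<Longrightarrow> v \<in> words X \<Longrightarrow> (u, v) \<in> r \<or> (v, u) \<in> r"
proof -
  have "refl_on (words X) r" "trans r" "antisym r" "total_on (words X) r"
    using well_order
    by (simp_all add: well_order_on_def linear_order_on_def partial_order_on_def preorder_on_def)
  then show "u \<in> words X \<Longrightarrow> (u, u) \<in> r"
    "(u, v) \<in> r \<Longrightarrow> (v, w) \<in> r \<Longrightarrow> (u, w) \<in> r"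
    "(u, v) \<in> r \<Longrightarrow> (v, u) \<in> r \<Longrightarrow> u = v"
    "u \<in> words X \<Longrightarrow> v \<in> words X \<Longrightarrow> (u, v) \<in> r \<or> (v, u) \<in> r"
    by (metis refl_onD, metis transD, metis antisymD, metis refl_onD total_on_def)
qed

lemma wf_wless: "wf {(v, u). wless r v u}"
proof -
  have "{(v, u). wless r v u} = r - Id" by (auto simp: wless_def)
  then show ?thesis using well_order by (simp add: well_order_on_def)
qed

lemma le_wless_trans: "(u, v) \<in> r \<Longrightarrow> wless r v w \<Longrightarrow> wless r u w"
  using order_trans order_antisym unfolding wless_def by blast

text \<open>Membership of both words in one hom-set makes all the products defined, so the
  monotonicity axiom applies first on the left and then on the right.\<close>

lemma wless_wcomp:
  assumes "wless r v u" "u \<in> hom_set X x y" "v \<in> hom_set X x y"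
    "a \<in> words X" "tgt a = x" "b \<in> words X" "src b = y"
  shows "wless r (a \<bullet>\<^sub>w v \<bullet>\<^sub>w b) (a \<bullet>\<^sub>w u \<bullet>\<^sub>w b)"
proof -
  have *: "u \<in> words X" "v \<in> words X" "src u = x" "src v = x" "tgt u = y" "tgt v = y"
    using assms by (auto simp: hom_set_def)
  moreover have "composable a u" "composable a v"
    using * assms by (simp_all add: composable_def)
  ultimately have "wless r (a \<bullet>\<^sub>w v) (a \<bullet>\<^sub>w u)"
    using monomial assms(1,4) unfolding monomial_order_def by meson
  moreover have "a \<bullet>\<^sub>w v \<in> words X" "a \<bullet>\<^sub>w u \<in> words X" using * assms by (auto intro: wcomp_words)
  moreover have "composable (a \<bullet>\<^sub>w v) b" "composable (a \<bullet>\<^sub>w u) b"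
    using * assms by (simp_all add: composable_def)
  ultimately show ?thesis
    using monomial assms(6) unfolding monomial_order_def by meson
qed

text \<open>A well-order provides least elements. Greatest elements come from finiteness and
  totality, one element at a time.\<close>

lemma ex_greatest_word:
  assumes "finite A" "A \<noteq> {}" "A \<subseteq> words X"
  shows "\<exists>u\<in>A. \<forall>v\<in>A. (v, u) \<in> r"
  using assms
proof (induction A rule: finite_ne_induct)
  case (singleton u)
  then show ?case by (simp add: order_refl)
next
  case (insert w A)
  then obtain u where u: "u \<in> A" "\<forall>v\<in>A. (v, u) \<in> r" by auto
  then consider "(w, u) \<in> r" | "(u, w) \<in> r" using order_total insert.prems by blast
  then show ?case
    by cases (use u order_trans order_refl insert.prems in blast)+
qed

lemma lead_eqI:
  "u \<in> Poly_Mapping.keys f \<Longrightarrow> (\<And>v. v \<in> Poly_Mapping.keys f \<Longrightarrow> (v, u) \<in> r) \<Longrightarrow> lead r f = u"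
  unfolding lead_def by (rule the_equality) (auto intro: order_antisym)

lemma lead_properties:
  assumes "f \<noteq> 0" "Poly_Mapping.keys f \<subseteq> words X"
  shows lead_in_keys: "lead r f \<in> Poly_Mapping.keys f"
    and keys_le_lead: "v \<in> Poly_Mapping.keys f \<Longrightarrow> (v, lead r f) \<in> r"
proof -
  obtain u where "u \<in> Poly_Mapping.keys f" "\<forall>v\<in>Poly_Mapping.keys f. (v, u) \<in> r"
    using ex_greatest_word[of "Poly_Mapping.keys f"] assms by auto
  moreover from this have "lead r f = u" by (intro lead_eqI) auto
  ultimately show "lead r f \<in> Poly_Mapping.keys f"
    "v \<in> Poly_Mapping.keys f \<Longrightarrow> (v, lead r f) \<in> r" by auto
qed

lemma hom_space_words: "f \<in> hom_space X x y \<Longrightarrow> Poly_Mapping.keys f \<subseteq> words X"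
  by (auto simp: hom_space_def hom_set_def)

lemma lead_in_hom_set: "f \<in> hom_space X x y \<Longrightarrow> f \<noteq> 0 \<Longrightarrow> lead r f \<in> hom_set X x y"
  using lead_in_keys[OF _ hom_space_words] by (auto simp: hom_space_def)

text \<open>The coefficients at the common leading word cancel, and all other words of the two
  supports lie strictly below it. This drives both division and the analysis of
  compositions.\<close>

lemma cancel_lead:
  assumes "f \<in> hom_space X x y" "f \<noteq> 0" "g \<in> hom_space X x y" "g \<noteq> 0" "lead r g = lead r f"
    "Poly_Mapping.lookup g (lead r f) = Poly_Mapping.lookup f (lead r f)" "v \<in> Poly_Mapping.keys (f - g)"
  shows "wless r v (lead r f)"
proof -
  have "v \<in> Poly_Mapping.keys f \<union> Poly_Mapping.keys g" "v \<noteq> lead r f"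
    using assms(6,7) by (auto simp: in_keys_iff lookup_minus)
  moreover from this have "(v, lead r f) \<in> r"
    using keys_le_lead[OF assms(2) hom_space_words[OF assms(1)], of v]
      keys_le_lead[OF assms(4) hom_space_words[OF assms(3)], of v] assms(5) by fastforce
  ultimately show ?thesis by (simp add: wless_def)
qed

end


section \<open>Values of \<open>S\<close>-words\<close>

lemma comb_value_Nil [simp]: "comb_value [] = 0"
  and comb_value_Cons [simp]: "comb_value ((\<alpha>, a, s, b) # ts) =
    pscale \<alpha> (pword a \<bullet>\<^sub>p s \<bullet>\<^sub>p pword b) + comb_value ts"
  and comb_value_append [simp]: "comb_value (ts @ us) = comb_value ts + comb_value us"
  by (simp_all add: comb_value_def)

lemma term_lead_simp [simp]: "term_lead r (\<alpha>, a, s, b) = a \<bullet>\<^sub>w lead r s \<bullet>\<^sub>w b"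
  by (simp add: term_lead_def)

locale monic_relations = monomial_category X r
  for X :: "('a, 'b) pre_digraph" and r :: "('a, 'b) word rel" +
  fixes S :: "('a, 'b, 'k::field) cpoly set"
  assumes relations: "S \<subseteq> kC X" and monic: "\<forall>s\<in>S. is_monic r s"
begin

text \<open>A relation is nonzero, so the hom-space that contains it can be read off from the end
  points of its leading word.\<close>

lemma relation_properties:
  assumes "s \<in> S"
  shows relation_nonzero: "s \<noteq> 0"
    and lookup_lead_relation: "Poly_Mapping.lookup s (lead r s) = 1"
    and lead_relation_words: "lead r s \<in> words X"
    and relation_hom_space: "s \<in> hom_space X (src (lead r s)) (tgt (lead r s))"
proof -
  show *: "s \<noteq> 0" "Poly_Mapping.lookup s (lead r s) = 1"
    using monic assms by (auto simp: is_monic_def)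
  obtain x y where xy: "s \<in> hom_space X x y" using relations assms by (auto simp: kC_def)
  then have "lead r s \<in> hom_set X x y" using * lead_in_hom_set by blast
  then show "lead r s \<in> words X" "s \<in> hom_space X (src (lead r s)) (tgt (lead r s))"
    using xy by (auto simp: hom_set_def)
qed

text \<open>All hom-spaces share the same zero function, but the leading word of a nonzero element
  fixes both end points.\<close>

lemma hom_space_lead_unique:
  assumes "f \<in> hom_space X x y" "f \<in> hom_space X x' y'" "f \<noteq> 0"
  shows "x' = x \<and> y' = y"
  using lead_in_hom_set[OF assms(1,3)] lead_in_hom_set[OF assms(2,3)] by (auto simp: hom_set_def)

text \<open>Replaces membership of \<open>s\<close> in a hom-space by composability of
  \<open>a\<close>, \<open>lead r s\<close> and \<open>b\<close>, the form in which factorizations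
  of words arise.\<close>

lemma S_words_iff:
  "(a, s, b) \<in> S_words X S x y \<longleftrightarrow> a \<in> words X \<and> s \<in> S \<and> b \<in> words X \<and>
     tgt a = src (lead r s) \<and> tgt (lead r s) = src b \<and> src a = x \<and> tgt b = y"
proof -
  have "s \<in> hom_space X (tgt a) (src b) \<longleftrightarrow> tgt a = src (lead r s) \<and> tgt (lead r s) = src b"
    if "s \<in> S"
    using relation_hom_space[OF that] hom_space_lead_unique[OF _ _ relation_nonzero[OF that]]
    by metis
  then show ?thesis unfolding S_words_def by blast
qed

text \<open>Multiplication by \<open>a\<close> and \<open>b\<close> is injective and strictly
  monotone on the support of \<open>s\<close>, so the product is again monic and its leading word is
  the product of \<open>a\<close>, the leading word of \<open>s\<close>, and
  \<open>b\<close>.\<close>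

lemma S_word_value:
  assumes "(a, s, b) \<in> S_words X S x y"
  defines "V \<equiv> pword a \<bullet>\<^sub>p s \<bullet>\<^sub>p pword b" and "w \<equiv> a \<bullet>\<^sub>w lead r s \<bullet>\<^sub>w b"
  shows S_word_hom_space: "V \<in> hom_space X x y"
    and lead_S_word: "lead r V = w"
    and lookup_lead_S_word: "Poly_Mapping.lookup V w = 1"
    and S_word_nonzero: "V \<noteq> 0"
    and lead_S_word_hom_set: "w \<in> hom_set X x y"
proof -
  have A: "a \<in> words X" "s \<in> S" "b \<in> words X" "tgt a = src (lead r s)" "tgt (lead r s) = src b"
    "src a = x" "tgt b = y"
    using assms(1) by (auto simp: S_words_iff)
  note s = relation_properties[OF A(2)]
  have hom: "u \<in> hom_set X (tgt a) (src b)" if "u \<in> Poly_Mapping.keys s" for u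
    using s(4) that A by (auto simp: hom_space_def)
  have lead_key: "lead r s \<in> Poly_Mapping.keys s" using s(2) by (auto simp: in_keys_iff)
  have V: "V = pushforward (\<lambda>u. a \<bullet>\<^sub>w u \<bullet>\<^sub>w b) s" by (simp add: V_def pword_pmult_pword)
  \<comment> \<open>All words of \<open>s\<close> have the same end points, so only their arc lists
    have to be recovered, and lists can be cancelled on both sides.\<close>
  have "inj_on (\<lambda>u. a \<bullet>\<^sub>w u \<bullet>\<^sub>w b) (Poly_Mapping.keys s)"
  proof (rule inj_onI)
    fix u v assume "u \<in> Poly_Mapping.keys s" "v \<in> Poly_Mapping.keys s"
      and eq: "a \<bullet>\<^sub>w u \<bullet>\<^sub>w b = a \<bullet>\<^sub>w v \<bullet>\<^sub>w b"
    then have "src u = src v" "tgt u = tgt v" using hom by (auto simp: hom_set_def)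
    moreover have "path_arcs (a \<bullet>\<^sub>w u \<bullet>\<^sub>w b) = path_arcs (a \<bullet>\<^sub>w v \<bullet>\<^sub>w b)" using eq by (rule arg_cong)
    ultimately show "u = v" by (simp add: word_eq_iff[of u v])
  qed
  from lookup_pushforward[OF this lead_key]
  show one: "Poly_Mapping.lookup V w = 1" by (simp add: V w_def s(2))
  then show "V \<noteq> 0" by auto
  show "w \<in> hom_set X x y"
    using A s(3) by (auto simp: w_def hom_set_def intro!: wcomp_words)
  show "V \<in> hom_space X x y"
    using comb_value_hom_space[OF wf_digraph_axioms, of "[(1, a, s, b)]" S x y] assms(1)
    by (simp add: V_def pscale_simps)
  have "w \<in> words X" using \<open>w \<in> hom_set X x y\<close> by (simp add: hom_set_def)
  show "lead r V = w"
  proof (rule lead_eqI)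
    show "w \<in> Poly_Mapping.keys V" using one by (simp add: in_keys_iff)
    fix v assume "v \<in> Poly_Mapping.keys V"
    then obtain u where u: "u \<in> Poly_Mapping.keys s" "v = a \<bullet>\<^sub>w u \<bullet>\<^sub>w b"
      using keys_pushforward unfolding V by blast
    show "(v, w) \<in> r"
    proof (cases "u = lead r s")
      case True
      then show ?thesis using u order_refl \<open>w \<in> words X\<close> by (simp add: w_def)
    next
      case False
      then have "wless r u (lead r s)"
        using keys_le_lead[OF s(1) hom_space_words[OF s(4)] u(1)] by (simp add: wless_def)
      from wless_wcomp[OF this hom[OF lead_key] hom[OF u(1)] A(1) _ A(3)]
      show ?thesis by (simp add: wless_def u(2) w_def)
    qed
  qed
qed


section \<open>Spans of \<open>S\<close>-words with restricted leading words\<close>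

text \<open>With \<open>P\<close> always true this is the part of the ideal between \<open>x\<close>
  and \<open>y\<close>; with \<open>P\<close> meaning "below \<open>w\<close>" it consists of the
  elements congruent to 0 modulo \<open>(S, w)\<close>. One notion thus serves both
  purposes.\<close>

definition S_span :: "'a \<Rightarrow> 'a \<Rightarrow> (('a, 'b) word \<Rightarrow> bool) \<Rightarrow> ('a, 'b, 'k) cpoly set" where
  "S_span x y P =
     {comb_value ts | ts. \<forall>t\<in>set ts. snd t \<in> S_words X S x y \<and> P (term_lead r t)}"

lemma S_span_0: "0 \<in> S_span x y P"
  unfolding S_span_def by (rule CollectI) (intro exI[of _ "[]"], simp)

lemma S_span_add:
  assumes "f \<in> S_span x y P" "g \<in> S_span x y P"
  shows "f + g \<in> S_span x y P"
proof -
  obtain ts us where "f = comb_value ts" "g = comb_value us"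
    "\<forall>t\<in>set (ts @ us). snd t \<in> S_words X S x y \<and> P (term_lead r t)"
    using assms unfolding S_span_def by auto
  then show ?thesis unfolding S_span_def by (intro CollectI exI[of _ "ts @ us"]) simp
qed

lemma S_word_in_S_span:
  assumes "(a, s, b) \<in> S_words X S x y" "P (a \<bullet>\<^sub>w lead r s \<bullet>\<^sub>w b)"
  shows "pscale \<alpha> (pword a \<bullet>\<^sub>p s \<bullet>\<^sub>p pword b) \<in> S_span x y P"
  unfolding S_span_def using assms by (intro CollectI exI[of _ "[(\<alpha>, a, s, b)]"]) simp

text \<open>Induction along the list of terms, stated for values so that the list itself stays
  hidden.\<close>

lemma S_span_induct [consumes 1, case_names zero add]:
  assumes "f \<in> S_span x y P" "Q 0"
    and step: "\<And>\<alpha> a s b g. (a, s, b) \<in> S_words X S x y \<Longrightarrow> P (a \<bullet>\<^sub>w lead r s \<bullet>\<^sub>w b) \<Longrightarrow>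
      g \<in> S_span x y P \<Longrightarrow> Q g \<Longrightarrow> Q (pscale \<alpha> (pword a \<bullet>\<^sub>p s \<bullet>\<^sub>p pword b) + g)"
  shows "Q f"
proof -
  obtain ts where "\<forall>t\<in>set ts. snd t \<in> S_words X S x y \<and> P (term_lead r t)" "f = comb_value ts"
    using assms(1) unfolding S_span_def by blast
  moreover have "Q (comb_value ts)"
    if "\<forall>t\<in>set ts. snd t \<in> S_words X S x y \<and> P (term_lead r t)" for ts
    using that
  proof (induction ts)
    case (Cons t ts)
    obtain \<alpha> a s b where t: "t = (\<alpha>, a, s, b)" by (cases t)
    have "comb_value ts \<in> S_span x y P" using Cons.prems by (auto simp: S_span_def)
    then show ?case using Cons step[of a s b "comb_value ts" \<alpha>] by (simp add: t)
  qed (simp add: assms(2))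
  ultimately show ?thesis by blast
qed

lemma S_span_mono: "f \<in> S_span x y P \<Longrightarrow> (\<And>u. P u \<Longrightarrow> Q u) \<Longrightarrow> f \<in> S_span x y Q"
  unfolding S_span_def by blast

lemma S_span_pscale: "f \<in> S_span x y P \<Longrightarrow> pscale c f \<in> S_span x y P"
proof (induction rule: S_span_induct)
  case (add \<alpha> a s b g)
  have "pscale (c * \<alpha>) (pword a \<bullet>\<^sub>p s \<bullet>\<^sub>p pword b) \<in> S_span x y P"
    using add by (intro S_word_in_S_span) auto
  then show ?case using add by (simp add: pscale_simps S_span_add)
qed (simp add: pscale_simps S_span_0)

lemma S_span_uminus: "f \<in> S_span x y P \<Longrightarrow> - f \<in> S_span x y P"
  using S_span_pscale[of f x y P "-1"] by (simp add: pscale_simps)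

lemma S_span_diff: "f \<in> S_span x y P \<Longrightarrow> g \<in> S_span x y P \<Longrightarrow> f - g \<in> S_span x y P"
  using S_span_add[of f x y P "- g"] S_span_uminus by simp

text \<open>By associativity the outer factors are absorbed: \<open>(c, s, d)\<close> becomes
  \<open>(a \<bullet>\<^sub>w c, s, d \<bullet>\<^sub>w b)\<close>. This lifts congruences from
  compositions to larger products.\<close>

lemma S_span_pushforward:
  assumes "f \<in> S_span p q P" "a \<in> words X" "src a = x" "tgt a = p" "b \<in> words X" "src b = q" "tgt b = y"
    and "\<And>u. u \<in> hom_set X p q \<Longrightarrow> P u \<Longrightarrow> Q (a \<bullet>\<^sub>w u \<bullet>\<^sub>w b)"
  shows "pushforward (\<lambda>u. a \<bullet>\<^sub>w u \<bullet>\<^sub>w b) f \<in> S_span x y Q"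
  using assms(1)
proof (induction rule: S_span_induct)
  case (add \<alpha> c s d g)
  have "Q (a \<bullet>\<^sub>w (c \<bullet>\<^sub>w lead r s \<bullet>\<^sub>w d) \<bullet>\<^sub>w b)"
    using add assms(8) lead_S_word_hom_set by blast
  moreover have "(a \<bullet>\<^sub>w c, s, d \<bullet>\<^sub>w b) \<in> S_words X S x y"
    using add(1) assms by (auto simp: S_words_iff intro!: wcomp_words)
  ultimately have "pscale \<alpha> (pword (a \<bullet>\<^sub>w c) \<bullet>\<^sub>p s \<bullet>\<^sub>p pword (d \<bullet>\<^sub>w b)) \<in> S_span x y Q"
    by (intro S_word_in_S_span) (simp_all add: wcomp_assoc)
  then show ?case
    using add by (simp add: pushforward_add pushforward_pscale pword_pmult_pword
        pushforward_pushforward wcomp_assoc S_span_add)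
qed (simp add: S_span_0)

lemma S_span_hom_space: "f \<in> S_span x y P \<Longrightarrow> f \<in> hom_space X x y"
  by (induction rule: S_span_induct) (auto intro: hom_space_closed S_word_hom_space)

text \<open>Each word of a combination occurs in one of its \<open>S\<close>-words, and is therefore
  bounded by the leading word of that \<open>S\<close>-word.\<close>

lemma S_span_keys:
  assumes "f \<in> S_span x y P" "v \<in> Poly_Mapping.keys f"
  obtains u where "u \<in> hom_set X x y" "P u" "(v, u) \<in> r"
proof -
  have "\<forall>v\<in>Poly_Mapping.keys f. \<exists>u\<in>hom_set X x y. P u \<and> (v, u) \<in> r"
    using assms(1)
  proof (induction rule: S_span_induct)
    case (add \<alpha> a s b g)
    let ?V = "pword a \<bullet>\<^sub>p s \<bullet>\<^sub>p pword b" and ?w = "a \<bullet>\<^sub>w lead r s \<bullet>\<^sub>w b"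
    note V = S_word_value[OF add(1)]
    show ?case
    proof
      fix v assume "v \<in> Poly_Mapping.keys (pscale \<alpha> ?V + g)"
      then consider "v \<in> Poly_Mapping.keys ?V" | "v \<in> Poly_Mapping.keys g"
        by (cases "v \<in> Poly_Mapping.keys g") (auto simp: in_keys_iff lookup_add)
      then show "\<exists>u\<in>hom_set X x y. P u \<and> (v, u) \<in> r"
      proof cases
        case 1
        then have "(v, ?w) \<in> r" using keys_le_lead[OF V(4) hom_space_words[OF V(1)]] V(2) by simp
        then show ?thesis using V(5) add(2) by blast
      qed (use add in blast)
    qed
  qed simp
  then show thesis using that assms(2) by blast
qed

section \<open>Ideals and congruences as spans\<close>

lemma hom_ideal_eq_S_span:
  assumes "x \<in> verts X" "y \<in> verts X"
  shows "hom_ideal X S x y = S_span x y (\<lambda>_. True)"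
  unfolding S_span_def set_eq_iff
  by (simp add: Id_gen_hom_iff[OF wf_digraph_axioms assms] split_beta conj_commute)

lemma S_combs_iff: "ts \<in> S_combs X S \<longleftrightarrow>
    (\<exists>x\<in>verts X. \<exists>y\<in>verts X. \<forall>t\<in>set ts. snd t \<in> S_words X S x y)"
  by (simp add: S_combs_def split_beta)

lemma Id_gen_iff: "f \<in> Id_gen X S \<longleftrightarrow> (\<exists>x\<in>verts X. \<exists>y\<in>verts X. f \<in> S_span x y (\<lambda>_. True))"
  unfolding Id_gen_def S_span_def image_iff Bex_def S_combs_iff by blast

text \<open>\<open>equiv_mod\<close> leaves the end points of its combination open. They agree with
  those of \<open>h\<close> if \<open>h\<close> is nonzero, and 0 lies in every span.\<close>

lemma equiv_mod_S_span:
  assumes "equiv_mod X r S w h 0" "h \<in> hom_space X x y"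
  shows "h \<in> S_span x y (\<lambda>u. wless r u w)"
proof -
  obtain ts x' y' where "\<forall>t\<in>set ts. snd t \<in> S_words X S x' y' \<and> wless r (term_lead r t) w"
    "h = comb_value ts"
    using assms(1) unfolding equiv_mod_def S_combs_iff Bex_def diff_zero by blast
  then have *: "h \<in> S_span x' y' (\<lambda>u. wless r u w)" unfolding S_span_def by blast
  then show ?thesis
    using hom_space_lead_unique[OF assms(2) S_span_hom_space[OF *]] S_span_0 by (cases "h = 0") auto
qed

lemma S_span_equiv_mod:
  assumes "x \<in> verts X" "y \<in> verts X" "h \<in> S_span x y (\<lambda>u. wless r u w)"
  shows "equiv_mod X r S w h 0"
  using assms unfolding equiv_mod_def S_span_def Bex_def S_combs_iff by auto

section \<open>Confluence\<close>

lemma GS_basis_S_span: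
  assumes "GS_basis X r S" "f \<in> S" "g \<in> S" "h \<in> hom_space X x y"
    "(w, h) \<in> inclusion_comps X r f g \<union> intersection_comps X r f g"
  shows "h \<in> S_span x y (\<lambda>u. wless r u w)"
proof -
  have "equiv_mod X r S w h 0" using assms(1,2,3,5) unfolding GS_basis_def by blast
  then show ?thesis using assms(4) by (rule equiv_mod_S_span)
qed

text \<open>
  Disjoint occurrences of the two leading words need no separate treatment since
  \<open>intersection_comps\<close> does not require an overlap.
\<close>

lemma S_word_confluence_aux:
  assumes GS: "GS_basis X r S"
    and 1: "(a, f, b) \<in> S_words X S x y" and 2: "(a', g, b') \<in> S_words X S x y"
    and w: "a \<bullet>\<^sub>w lead r f \<bullet>\<^sub>w b = a' \<bullet>\<^sub>w lead r g \<bullet>\<^sub>w b'"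
    and len: "length (path_arcs a) \<le> length (path_arcs a')"
  shows "pword a \<bullet>\<^sub>p f \<bullet>\<^sub>p pword b - pword a' \<bullet>\<^sub>p g \<bullet>\<^sub>p pword b'
    \<in> S_span x y (\<lambda>u. wless r u (a \<bullet>\<^sub>w lead r f \<bullet>\<^sub>w b))"
proof -
  have A: "a \<in> words X" "f \<in> S" "b \<in> words X" "tgt a = src (lead r f)" "tgt (lead r f) = src b"
      "src a = x" "tgt b = y"
    and B: "a' \<in> words X" "g \<in> S" "b' \<in> words X" "tgt a' = src (lead r g)"
      "tgt (lead r g) = src b'" "src a' = x" "tgt b' = y"
    using 1 2 by (simp_all add: S_words_iff)
  let ?f = "lead r f" and ?g = "lead r g"
  note f = relation_properties[OF A(2)] and g = relation_properties[OF B(2)]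
  have paths: "path_arcs a @ path_arcs ?f @ path_arcs b = path_arcs a' @ path_arcs ?g @ path_arcs b'"
    using arg_cong[OF w, of path_arcs] by simp
  obtain q where q: "path_arcs a' = path_arcs a @ q"
      "path_arcs ?f @ path_arcs b = q @ path_arcs ?g @ path_arcs b'"
    using append_eq_append_longer[OF paths len] .
  \<comment> \<open>\<open>c\<close> is the path from the start of the occurrence of
    \<open>lead r f\<close> to the start of the occurrence of \<open>lead r g\<close>.\<close>
  obtain c where c: "c \<in> words X" "path_arcs c = q" "src c = tgt a" "a' = a \<bullet>\<^sub>w c"
    using word_cancel_prefix[OF A(1) B(1) _ q(1)] A(6) B(6) by metis
  have tc: "tgt c = src ?g" using B(4) c(4) by simp
  \<comment> \<open>The factor \<open>a\<close> lies to the left of both occurrences. It thus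
    suffices to treat the remaining word \<open>w'\<close>, with the common right factor
    \<open>e\<close> removed as well.\<close>
  have reduce: "pushforward (\<lambda>u. a \<bullet>\<^sub>w u \<bullet>\<^sub>w e) h \<in> S_span x y (\<lambda>u. wless r u (a \<bullet>\<^sub>w w' \<bullet>\<^sub>w e))"
    if "h \<in> S_span (src ?f) z (\<lambda>u. wless r u w')" "w' \<in> hom_set X (src ?f) z"
      "e \<in> words X" "src e = z" "tgt e = y" for h w' z e
    using that A by (intro S_span_pushforward[OF that(1)] wless_wcomp) auto
  show ?thesis
  proof (cases "length (path_arcs b) \<le> length (path_arcs b')")
    \<comment> \<open>The occurrence of \<open>lead r g\<close> starts no earlier and ends no later
      than that of \<open>lead r f\<close>, so this is a composition of inclusion with
      \<open>b' = d \<bullet>\<^sub>w b\<close>.\<close>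
    case True
    have "length (q @ path_arcs ?g) \<le> length (path_arcs ?f)"
      using True arg_cong[OF q(2), of length] by simp
    then obtain q' where q': "path_arcs b' = q' @ path_arcs b" "path_arcs ?f = q @ path_arcs ?g @ q'"
      using append_eq_append_longer[of "q @ path_arcs ?g" "path_arcs b'" "path_arcs ?f" "path_arcs b"]
        q(2) by (metis append_assoc)
    obtain d where d: "d \<in> words X" "path_arcs d = q'" "tgt d = src b" "b' = d \<bullet>\<^sub>w b"
      using word_cancel_suffix[OF A(3) B(3) _ q'(1)] A(7) B(7) by metis
    have sd: "src d = tgt ?g" using B(5) d(4) by simp
    have lf: "?f = c \<bullet>\<^sub>w ?g \<bullet>\<^sub>w d"
      unfolding word_eq_iff[of ?f] using q'(2) A(4,5) c d by simp
    define h where "h = f - pword c \<bullet>\<^sub>p g \<bullet>\<^sub>p pword d"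
    have S: "(c, g, d) \<in> S_words X S (src ?f) (src b)"
      using c d tc sd B(2) A(4) by (simp add: S_words_iff)
    have "h \<in> hom_space X (src ?f) (src b)"
      unfolding h_def using f(4) A(5) S_word_hom_space[OF S] by (intro hom_space_closed) simp_all
    moreover have "(?f, h) \<in> inclusion_comps X r f g"
      unfolding inclusion_comps_def composable_def h_def using c(1) d(1) tc sd lf f(3)
      by (intro CollectI exI[of _ ?f] exI[of _ c] exI[of _ d]) simp
    ultimately have "h \<in> S_span (src ?f) (src b) (\<lambda>u. wless r u ?f)"
      using GS_basis_S_span[OF GS A(2) B(2)] by blast
    then have "pushforward (\<lambda>u. a \<bullet>\<^sub>w u \<bullet>\<^sub>w b) h \<in> S_span x y (\<lambda>u. wless r u (a \<bullet>\<^sub>w ?f \<bullet>\<^sub>w b))"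
      by (rule reduce) (use A f(3) in \<open>simp_all add: hom_set_def\<close>)
    then show ?thesis
      by (simp add: h_def pushforward_diff pword_pmult_pword pushforward_pushforward c(4) d(4)
          wcomp_assoc)
  next
    \<comment> \<open>The occurrence of \<open>lead r g\<close> ends after that of
      \<open>lead r f\<close>, so this is a composition of intersection with
      \<open>b = d \<bullet>\<^sub>w b'\<close>.\<close>
    case False
    have "length (path_arcs ?f) \<le> length (q @ path_arcs ?g)"
      using False arg_cong[OF q(2), of length] by simp
    then obtain q' where q': "path_arcs b = q' @ path_arcs b'" "path_arcs ?f @ q' = q @ path_arcs ?g"
      using append_eq_append_longer[of "path_arcs ?f" "path_arcs b" "q @ path_arcs ?g" "path_arcs b'"]
        q(2) by (metis append_assoc)
    obtain d where d: "d \<in> words X" "path_arcs d = q'" "tgt d = src b'" "b = d \<bullet>\<^sub>w b'"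
      using word_cancel_suffix[OF B(3) A(3) _ q'(1)] A(7) B(7) by metis
    have sd: "src d = tgt ?f" using A(5) d(4) by simp
    have lf: "?f \<bullet>\<^sub>w d = c \<bullet>\<^sub>w ?g"
      unfolding word_eq_iff[of "?f \<bullet>\<^sub>w d"] using q'(2) A(4) B(5) c d by simp
    have fd: "?f \<bullet>\<^sub>w d \<in> words X" using f(3) d(1) sd by (intro wcomp_words) simp_all
    define h where "h = f \<bullet>\<^sub>p pword d - pword c \<bullet>\<^sub>p g"
    have "f \<bullet>\<^sub>p pword d \<in> hom_space X (src ?f) (src b')"
      using pmult_hom_space[OF wf_digraph_axioms f(4)] pword_hom_space[OF d(1)] sd d(3) by metis
    moreover have "pword c \<bullet>\<^sub>p g \<in> hom_space X (src ?f) (src b')"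
      using pmult_hom_space[OF wf_digraph_axioms pword_hom_space[OF c(1)]] g(4) tc c(3) A(4) B(5)
      by metis
    ultimately have "h \<in> hom_space X (src ?f) (src b')"
      unfolding h_def by (rule hom_space_closed)
    moreover have "(?f \<bullet>\<^sub>w d, h) \<in> intersection_comps X r f g"
      unfolding intersection_comps_def composable_def h_def using c(1) d(1) tc sd lf fd
      by (intro CollectI exI[of _ "?f \<bullet>\<^sub>w d"] exI[of _ c] exI[of _ d]) simp
    ultimately have "h \<in> S_span (src ?f) (src b') (\<lambda>u. wless r u (?f \<bullet>\<^sub>w d))"
      using GS_basis_S_span[OF GS A(2) B(2)] by blast
    then have "pushforward (\<lambda>u. a \<bullet>\<^sub>w u \<bullet>\<^sub>w b') h
        \<in> S_span x y (\<lambda>u. wless r u (a \<bullet>\<^sub>w (?f \<bullet>\<^sub>w d) \<bullet>\<^sub>w b'))"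
      by (rule reduce) (use B d fd in \<open>simp_all add: hom_set_def\<close>)
    then show ?thesis
      by (simp add: h_def pushforward_diff pword_pmult_pword pmult_pword pword_pmult
          pushforward_pushforward c(4) d(4) wcomp_assoc)
  qed
qed

text \<open>The difference changes only its sign when the two \<open>S\<close>-words are exchanged,
  so the one with the shorter left factor may be taken first.\<close>

lemma S_word_confluence:
  assumes "GS_basis X r S" "(a, f, b) \<in> S_words X S x y" "(a', g, b') \<in> S_words X S x y"
    "a \<bullet>\<^sub>w lead r f \<bullet>\<^sub>w b = w" "a' \<bullet>\<^sub>w lead r g \<bullet>\<^sub>w b' = w"
  shows "pword a \<bullet>\<^sub>p f \<bullet>\<^sub>p pword b - pword a' \<bullet>\<^sub>p g \<bullet>\<^sub>p pword b' \<in> S_span x y (\<lambda>u. wless r u w)"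
proof (cases "length (path_arcs a) \<le> length (path_arcs a')")
  case True
  then show ?thesis using S_word_confluence_aux[OF assms(1-3)] assms(4,5) by simp
next
  case False
  then have "pword a' \<bullet>\<^sub>p g \<bullet>\<^sub>p pword b' - pword a \<bullet>\<^sub>p f \<bullet>\<^sub>p pword b \<in> S_span x y (\<lambda>u. wless r u w)"
    using S_word_confluence_aux[OF assms(1,3,2)] assms(4,5) by simp
  from S_span_uminus[OF this] show ?thesis by simp
qed


section \<open>Leading words of ideal elements\<close>

lemma reducible_iff:
  assumes "u \<in> words X"
  shows "u \<notin> Irr X r S \<longleftrightarrow> (\<exists>s\<in>S. \<exists>a\<in>words X. \<exists>b\<in>words X.
    composable a (lead r s) \<and> composable (lead r s) b \<and> u = a \<bullet>\<^sub>w lead r s \<bullet>\<^sub>w b)"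
  using assms unfolding Irr_def by blast

lemma S_word_reducible:
  assumes "(a, s, b) \<in> S_words X S x y"
  shows "a \<bullet>\<^sub>w lead r s \<bullet>\<^sub>w b \<notin> Irr X r S"
  using assms by (auto simp: S_words_iff Irr_def composable_def)

lemma reducible_S_word:
  assumes "u \<in> hom_set X x y" "u \<notin> Irr X r S"
  obtains a s b where "(a, s, b) \<in> S_words X S x y" "u = a \<bullet>\<^sub>w lead r s \<bullet>\<^sub>w b"
proof -
  have u: "u \<in> words X" "src u = x" "tgt u = y" using assms(1) by (auto simp: hom_set_def)
  then obtain a s b where "a \<in> words X" "b \<in> words X" "s \<in> S" "tgt a = src (lead r s)"
      "tgt (lead r s) = src b" "u = a \<bullet>\<^sub>w lead r s \<bullet>\<^sub>w b"
    using assms(2) unfolding reducible_iff[OF u(1)] composable_def by blast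
  with u that[of a s b] show thesis by (simp add: S_words_iff)
qed

text \<open>By confluence, any two \<open>S\<close>-words with leading word \<open>w\<close> are
  interchangeable modulo lower ones, so all of them collapse to a multiple of a single one. The
  coefficient may be 0, so the alternatives can overlap.\<close>

lemma S_span_top_term:
  assumes GS: "GS_basis X r S" and f: "f \<in> S_span x y (\<lambda>u. (u, w) \<in> r)"
  shows "f \<in> S_span x y (\<lambda>u. wless r u w) \<or>
    (\<exists>\<alpha> a s b. (a, s, b) \<in> S_words X S x y \<and> a \<bullet>\<^sub>w lead r s \<bullet>\<^sub>w b = w \<and>
       f - pscale \<alpha> (pword a \<bullet>\<^sub>p s \<bullet>\<^sub>p pword b) \<in> S_span x y (\<lambda>u. wless r u w))"
    (is "?low f \<or> ?top f")
  using f
proof (induction rule: S_span_induct)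
  case zero
  show ?case by (simp add: S_span_0)
next
  case (add \<alpha> a s b g)
  let ?V = "pword a \<bullet>\<^sub>p s \<bullet>\<^sub>p pword b" and ?L = "S_span x y (\<lambda>u. wless r u w)"
  show ?case
  proof (cases "a \<bullet>\<^sub>w lead r s \<bullet>\<^sub>w b = w")
    case True
    show ?thesis
    proof (cases "?low g")
      case low: True
      have "pscale \<alpha> ?V + g - pscale \<alpha> ?V \<in> ?L" using low by simp
      then show ?thesis using True add(1) by blast
    next
      case False
      then obtain \<beta> a' s' b' where *: "(a', s', b') \<in> S_words X S x y"
          "a' \<bullet>\<^sub>w lead r s' \<bullet>\<^sub>w b' = w"
          "g - pscale \<beta> (pword a' \<bullet>\<^sub>p s' \<bullet>\<^sub>p pword b') \<in> ?L"
        using add.IH by blast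
      let ?V' = "pword a' \<bullet>\<^sub>p s' \<bullet>\<^sub>p pword b'"
      \<comment> \<open>Exchanging \<open>?V\<close> for \<open>?V'\<close> costs only lower terms
        and lets the coefficients add up to \<open>\<alpha> + \<beta>\<close>.\<close>
      have "pscale \<alpha> (?V - ?V') + (g - pscale \<beta> ?V') \<in> ?L"
        using S_word_confluence[OF GS add(1) *(1) True *(2)] *(3)
        by (intro S_span_add S_span_pscale)
      also have "pscale \<alpha> (?V - ?V') + (g - pscale \<beta> ?V') =
          pscale \<alpha> ?V + g - pscale (\<alpha> + \<beta>) ?V'"
        by (simp add: pscale_simps algebra_simps)
      finally show ?thesis using * by blast
    qed
  next
    case False
    then have V: "pscale \<alpha> ?V \<in> ?L"
      using add(1,2) by (intro S_word_in_S_span) (simp_all add: wless_def)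
    show ?thesis
    proof (cases "?low g")
      case True
      then show ?thesis using S_span_add[OF V] by blast
    next
      case False
      then obtain \<beta> a' s' b' where *: "(a', s', b') \<in> S_words X S x y"
          "a' \<bullet>\<^sub>w lead r s' \<bullet>\<^sub>w b' = w"
          "g - pscale \<beta> (pword a' \<bullet>\<^sub>p s' \<bullet>\<^sub>p pword b') \<in> ?L"
        using add.IH by blast
      then have "pscale \<alpha> ?V + g - pscale \<beta> (pword a' \<bullet>\<^sub>p s' \<bullet>\<^sub>p pword b') \<in> ?L"
        using S_span_add[OF V *(3)] by (simp add: algebra_simps)
      then show ?thesis using * by blast
    qed
  qed
qed

text \<open>A nonzero value has a nonempty list of terms, and \<open>w\<close> is the greatest of
  their finitely many leading words. Since it is one of them, it inherits \<open>P\<close>.\<close>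

lemma S_span_bounded:
  assumes "f \<in> S_span x y P" "f \<noteq> 0"
  obtains w where "P w" "f \<in> S_span x y (\<lambda>u. (u, w) \<in> r)"
proof -
  obtain ts where ts: "\<forall>t\<in>set ts. snd t \<in> S_words X S x y \<and> P (term_lead r t)" "f = comb_value ts"
    using assms(1) unfolding S_span_def by blast
  have "term_lead r ` set ts \<subseteq> words X"
  proof
    fix u assume "u \<in> term_lead r ` set ts"
    then obtain \<alpha> a s b where "u = a \<bullet>\<^sub>w lead r s \<bullet>\<^sub>w b" "(a, s, b) \<in> S_words X S x y"
      using ts(1) by (auto simp: term_lead_def)
    then show "u \<in> words X" using lead_S_word_hom_set by (auto simp: hom_set_def)
  qed
  moreover have "ts \<noteq> []" using ts(2) assms(2) by auto
  ultimately obtain t where "t \<in> set ts" "\<forall>t'\<in>set ts. (term_lead r t', term_lead r t) \<in> r"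
    using ex_greatest_word[of "term_lead r ` set ts"] by auto
  with ts that[of "term_lead r t"] show thesis unfolding S_span_def by blast
qed

text \<open>The lower \<open>S\<close>-words contain only words strictly below \<open>w\<close>, so
  nothing can cancel the coefficient \<open>\<alpha>\<close> at \<open>w\<close>.\<close>

lemma lead_top_term:
  assumes S: "(a, s, b) \<in> S_words X S x y" "a \<bullet>\<^sub>w lead r s \<bullet>\<^sub>w b = w" and "\<alpha> \<noteq> 0"
    and low: "f - pscale \<alpha> (pword a \<bullet>\<^sub>p s \<bullet>\<^sub>p pword b) \<in> S_span x y (\<lambda>u. wless r u w)"
  shows "lead r f = w"
proof -
  let ?V = "pword a \<bullet>\<^sub>p s \<bullet>\<^sub>p pword b"
  have w: "w \<in> words X" using lead_S_word_hom_set[OF S(1)] S(2) by (simp add: hom_set_def)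
  have "w \<notin> Poly_Mapping.keys (f - pscale \<alpha> ?V)"
  proof
    assume "w \<in> Poly_Mapping.keys (f - pscale \<alpha> ?V)"
    then obtain u where "wless r u w" "(w, u) \<in> r" by (rule S_span_keys[OF low])
    then show False using order_antisym[of u w] by (simp add: wless_def)
  qed
  then have "Poly_Mapping.lookup f w = \<alpha>"
    using lookup_lead_S_word[OF S(1)] S(2) by (simp add: in_keys_iff lookup_minus)
  then have key: "w \<in> Poly_Mapping.keys f" using \<open>\<alpha> \<noteq> 0\<close> by (simp add: in_keys_iff)
  have "pscale \<alpha> ?V \<in> S_span x y (\<lambda>u. (u, w) \<in> r)"
    using S order_refl[OF w] by (intro S_word_in_S_span) simp_all
  moreover have "f - pscale \<alpha> ?V \<in> S_span x y (\<lambda>u. (u, w) \<in> r)"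
    using low by (rule S_span_mono) (simp add: wless_def)
  ultimately have "pscale \<alpha> ?V + (f - pscale \<alpha> ?V) \<in> S_span x y (\<lambda>u. (u, w) \<in> r)"
    by (rule S_span_add)
  then have "f \<in> S_span x y (\<lambda>u. (u, w) \<in> r)" by simp
  then show ?thesis
    using key by (intro lead_eqI) (use S_span_keys order_trans in blast)+
qed

text \<open>Well-founded induction on a bound \<open>w\<close> for the leading words of the terms.
  Either the bound can be lowered, or one term at \<open>w\<close> survives and determines the
  leading word of \<open>f\<close>.\<close>

lemma GS_basis_lead_reducible:
  assumes GS: "GS_basis X r S" and f: "f \<in> S_span x y (\<lambda>_. True)" "f \<noteq> 0"
  shows "lead r f \<notin> Irr X r S"
proof -
  have "lead r f \<notin> Irr X r S" if "f \<in> S_span x y (\<lambda>u. (u, w) \<in> r)" for w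
    using that
  proof (induction w rule: wf_induct_rule[OF wf_wless])
    case (1 w)
    show ?case
    proof (cases "f \<in> S_span x y (\<lambda>u. wless r u w)")
      case True
      then obtain w' where "wless r w' w" "f \<in> S_span x y (\<lambda>u. (u, w') \<in> r)"
        using S_span_bounded f(2) by blast
      then show ?thesis using 1 by blast
    next
      case False
      then obtain \<alpha> a s b where *: "(a, s, b) \<in> S_words X S x y" "a \<bullet>\<^sub>w lead r s \<bullet>\<^sub>w b = w"
          "f - pscale \<alpha> (pword a \<bullet>\<^sub>p s \<bullet>\<^sub>p pword b) \<in> S_span x y (\<lambda>u. wless r u w)"
        using S_span_top_term[OF GS 1(2)] by blast
      \<comment> \<open>For \<open>\<alpha> = 0\<close> the third fact would put \<open>f\<close>
        itself into the lower span.\<close>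
      from * False have "\<alpha> \<noteq> 0" by auto
      then have "lead r f = w" using lead_top_term *  by blast
      then show ?thesis using S_word_reducible[OF *(1)] *(2) by simp
    qed
  qed
  then show ?thesis using S_span_bounded[OF f] by blast
qed


section \<open>Division with remainder\<close>

text \<open>Induction on the leading word: it is cancelled by a multiple of an \<open>S\<close>-word
  if reducible and moved to the remainder otherwise. The last conjunct records that an irreducible
  leading word survives in the remainder.\<close>

lemma division:
  assumes "f \<in> hom_space X x y" "f \<noteq> 0"
  shows "\<exists>ts p. (\<forall>t\<in>set ts. snd t \<in> S_words X S x y \<and> (term_lead r t, lead r f) \<in> r) \<and>
    sorted_wrt (\<lambda>t t'. wless r (term_lead r t') (term_lead r t)) ts \<and> f = comb_value ts + p \<and>
    Poly_Mapping.keys p \<subseteq> Irr X r S \<and> (\<forall>v\<in>Poly_Mapping.keys p. (v, lead r f) \<in> r) \<and>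
    (lead r f \<in> Irr X r S \<longrightarrow> p \<noteq> 0)"
  using assms
proof (induction "lead r f" arbitrary: f rule: wf_induct_rule[OF wf_wless])
  case 1
  let ?w = "lead r f" and ?c = "Poly_Mapping.lookup f (lead r f)"
  have w: "?w \<in> hom_set X x y" "?w \<in> words X"
    using lead_in_hom_set[OF 1(2,3)] by (auto simp: hom_set_def)
  have c: "?c \<noteq> 0" using lead_in_keys[OF 1(3) hom_space_words[OF 1(2)]] by (simp add: in_keys_iff)
  \<comment> \<open>Here \<open>g\<close> stands for the part split off, either the leading monomial
    or a scaled \<open>S\<close>-word. It matches \<open>f\<close> at \<open>?w\<close>, so the
    induction hypothesis applies to \<open>f - g\<close> with strict bounds.\<close>
  have rest: "\<exists>ts p. (\<forall>t\<in>set ts. snd t \<in> S_words X S x y \<and> wless r (term_lead r t) ?w) \<and>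
      sorted_wrt (\<lambda>t t'. wless r (term_lead r t') (term_lead r t)) ts \<and> f - g = comb_value ts + p \<and>
      Poly_Mapping.keys p \<subseteq> Irr X r S \<and> (\<forall>v\<in>Poly_Mapping.keys p. wless r v ?w)"
    if g: "g \<in> hom_space X x y" "lead r g = ?w" "Poly_Mapping.lookup g ?w = ?c" for g
  proof (cases "f - g = 0")
    case True
    then show ?thesis by (intro exI[of _ "[]"] exI[of _ 0]) simp
  next
    case False
    have h: "f - g \<in> hom_space X x y" using 1(2) g(1) by (rule hom_space_closed)
    have "g \<noteq> 0" using g(3) c by auto
    then have less: "wless r (lead r (f - g)) ?w"
      using cancel_lead[OF 1(2,3) g(1)] g(2,3) lead_in_keys[OF False hom_space_words[OF h]] by blast
    from 1(1)[OF _ h False] less show ?thesis using le_wless_trans[OF _ less] by blast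
  qed
  show ?case
  proof (cases "?w \<in> Irr X r S")
    case True
    let ?g = "Poly_Mapping.single ?w ?c"
    have "?g \<in> hom_space X x y" using w(1) by (auto simp: hom_space_def)
    moreover have "lead r ?g = ?w" using c w(2) order_refl by (intro lead_eqI) auto
    ultimately obtain ts p where *:
        "\<forall>t\<in>set ts. snd t \<in> S_words X S x y \<and> wless r (term_lead r t) ?w"
        "sorted_wrt (\<lambda>t t'. wless r (term_lead r t') (term_lead r t)) ts" "f - ?g = comb_value ts + p"
        "Poly_Mapping.keys p \<subseteq> Irr X r S" "\<forall>v\<in>Poly_Mapping.keys p. wless r v ?w"
      using rest[of ?g] by auto
    \<comment> \<open>The words of \<open>p\<close> are strictly below \<open>?w\<close>, so adding
      the leading monomial to \<open>p\<close> leaves the coefficient \<open>?c\<close>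
      intact.\<close>
    have "?w \<notin> Poly_Mapping.keys p" using *(5) by (auto simp: wless_def)
    then have "Poly_Mapping.lookup (?g + p) ?w \<noteq> 0" using c by (simp add: lookup_add in_keys_iff)
    then have nz: "?g + p \<noteq> 0" by auto
    have keys: "Poly_Mapping.keys (?g + p) \<subseteq> insert ?w (Poly_Mapping.keys p)"
      using Poly_Mapping.keys_add[of ?g p] by (auto split: if_splits)
    have "f = comb_value ts + (?g + p)" using *(3) by (simp add: algebra_simps)
    moreover have "Poly_Mapping.keys (?g + p) \<subseteq> Irr X r S" using keys *(4) True by blast
    moreover have "\<forall>v\<in>Poly_Mapping.keys (?g + p). (v, ?w) \<in> r"
      using keys *(5) order_refl[OF w(2)] unfolding wless_def by blast
    ultimately show ?thesis using *(1,2) nz unfolding wless_def by blast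
  next
    case False
    obtain a s b where S: "(a, s, b) \<in> S_words X S x y" "?w = a \<bullet>\<^sub>w lead r s \<bullet>\<^sub>w b"
      using reducible_S_word[OF w(1) False] .
    let ?V = "pword a \<bullet>\<^sub>p s \<bullet>\<^sub>p pword b"
    note V = S_word_value[OF S(1), folded S(2)]
    have "Poly_Mapping.keys (pscale ?c ?V) = Poly_Mapping.keys ?V" using c by (auto simp: in_keys_iff)
    then have "lead r (pscale ?c ?V) = lead r ?V" by (simp add: lead_def)
    then obtain ts p where *:
        "\<forall>t\<in>set ts. snd t \<in> S_words X S x y \<and> wless r (term_lead r t) ?w"
        "sorted_wrt (\<lambda>t t'. wless r (term_lead r t') (term_lead r t)) ts"
        "f - pscale ?c ?V = comb_value ts + p"
        "Poly_Mapping.keys p \<subseteq> Irr X r S" "\<forall>v\<in>Poly_Mapping.keys p. wless r v ?w"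
      using rest[of "pscale ?c ?V"] V by (auto simp: hom_space_closed)
    let ?ts = "(?c, a, s, b) # ts"
    have "\<forall>t\<in>set ?ts. snd t \<in> S_words X S x y \<and> (term_lead r t, ?w) \<in> r"
      using *(1) S order_refl[OF w(2)] by (simp add: wless_def)
    \<comment> \<open>The strict bounds from \<open>rest\<close> place the new head above every
      later term.\<close>
    moreover have "sorted_wrt (\<lambda>t t'. wless r (term_lead r t') (term_lead r t)) ?ts"
      using *(1,2) S(2) by simp
    moreover have "f = comb_value ?ts + p" using *(3) by (simp add: algebra_simps)
    moreover have "\<forall>v\<in>Poly_Mapping.keys p. (v, ?w) \<in> r" using *(5) by (simp add: wless_def)
    ultimately show ?thesis using *(4) False by blast
  qed
qed

end


section \<open>Bases of the quotient hom-spaces\<close>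

locale quotient_hom_space = wf_digraph X for X :: "('a, 'b) pre_digraph" +
  fixes S :: "('a, 'b, 'k::field) cpoly set" and x y :: 'a
  assumes verts: "x \<in> verts X" "y \<in> verts X"
begin

abbreviation N :: "('a, 'b, 'k) cpoly set" where "N \<equiv> hom_ideal X S x y"

abbreviation Q :: "('k, ('a, 'b, 'k) cpoly set) module" where "Q \<equiv> quot_hom X S x y"

text \<open>Extends \<open>quot_class\<close> from words to arbitrary polynomials, so that the
  operations of \<open>Q\<close> can be computed on representatives.\<close>

definition residue :: "('a, 'b, 'k) cpoly \<Rightarrow> ('a, 'b, 'k) cpoly set" where
  "residue f = N +>\<^bsub>hom_module X x y\<^esub> f"

lemmas N_closed = hom_ideal_closed[OF wf_digraph_axioms verts]

lemma N_diff: "f \<in> N \<Longrightarrow> g \<in> N \<Longrightarrow> f - g \<in> N"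
  using N_closed(2)[of f S "pscale (- 1) g"] N_closed(3)[of g S "- 1"] by (simp add: pscale_simps)

lemma residue_iff: "h \<in> residue f \<longleftrightarrow> h - f \<in> N"
  unfolding residue_def a_r_coset_def' by (auto simp: hom_module_def intro: bexI[of _ "h - f"])

lemma residue_eq_iff: "residue f = residue g \<longleftrightarrow> f - g \<in> N"
proof
  assume "residue f = residue g"
  then show "f - g \<in> N" using N_closed(1) residue_iff[of f f] residue_iff[of f g] by simp
next
  assume *: "f - g \<in> N"
  show "residue f = residue g"
  proof (rule Set.set_eqI)
    fix h
    show "h \<in> residue f \<longleftrightarrow> h \<in> residue g"
      using N_closed(2)[OF _ *, of "h - f"] N_diff[OF _ *, of "h - g"] by (auto simp: residue_iff)
  qed
qed

section \<open>The quotient operations on representatives\<close>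

lemma carrier_Q: "carrier Q = residue ` hom_space X x y"
  unfolding quot_hom_def quot_module_def A_RCOSETS_def' residue_def by (auto simp: hom_module_def)

lemma zero_Q: "\<zero>\<^bsub>Q\<^esub> = residue 0"
  unfolding quot_hom_def quot_module_def by (auto simp: residue_iff)

lemma add_Q: "residue f \<oplus>\<^bsub>Q\<^esub> residue g = residue (f + g)"
proof (rule Set.set_eqI)
  fix h
  have "h \<in> residue f \<oplus>\<^bsub>Q\<^esub> residue g \<longleftrightarrow> (\<exists>f'\<in>residue f. \<exists>g'\<in>residue g. h = f' + g')"
    unfolding quot_hom_def quot_module_def by (simp add: set_add_def set_mult_def hom_module_def)
  also have "\<dots> \<longleftrightarrow> h \<in> residue (f + g)"
  proof
    assume "\<exists>f'\<in>residue f. \<exists>g'\<in>residue g. h = f' + g'"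
    then obtain f' g' where "f' - f \<in> N" "g' - g \<in> N" "h = f' + g'" by (auto simp: residue_iff)
    then show "h \<in> residue (f + g)"
      using N_closed(2)[of "f' - f" S "g' - g"] by (simp add: residue_iff algebra_simps)
  next
    assume "h \<in> residue (f + g)"
    then have "h - g \<in> residue f" "g \<in> residue g" "h = (h - g) + g"
      using N_closed(1) by (auto simp: residue_iff algebra_simps)
    then show "\<exists>f'\<in>residue f. \<exists>g'\<in>residue g. h = f' + g'" by blast
  qed
  finally show "h \<in> residue f \<oplus>\<^bsub>Q\<^esub> residue g \<longleftrightarrow> h \<in> residue (f + g)" .
qed

lemma smult_Q: "c \<odot>\<^bsub>Q\<^esub> residue f = residue (pscale c f)"
proof -
  have "c \<odot>\<^bsub>Q\<^esub> residue f = (\<Union>g\<in>residue f. residue (pscale c g))"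
    unfolding quot_hom_def quot_module_def by (simp add: residue_def hom_module_def)
  \<comment> \<open>The union defining the scalar multiple has only equal members, because
    \<open>N\<close> is closed under scaling.\<close>
  moreover have "residue (pscale c g) = residue (pscale c f)" if "g \<in> residue f" for g
    using N_closed(3)[of "g - f" S c] that by (simp add: residue_eq_iff residue_iff pscale_simps)
  moreover have "f \<in> residue f" using N_closed(1) by (simp add: residue_iff)
  ultimately show ?thesis by blast
qed

sublocale Q: vectorspace class_ring Q
  by (rule quot_hom_vectorspace[OF wf_digraph_axioms verts])

lemma quot_class_residue: "quot_class X S x y u = residue (pword u)"
  by (simp add: quot_class_def residue_def)

lemma quot_class_carrier: "u \<in> hom_set X x y \<Longrightarrow> quot_class X S x y u \<in> carrier Q"
  by (auto simp: quot_class_residue carrier_Q pword_def hom_space_def)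

text \<open>Coefficients in \<open>Q.lincomb\<close> are indexed by classes. Injectivity ensures
  that each class is counted for exactly one word.\<close>

lemma lincomb_quot_class:
  assumes "finite A" "A \<subseteq> hom_set X x y" "inj_on (quot_class X S x y) A"
  shows "Q.lincomb a (quot_class X S x y ` A) =
    residue (\<Sum>u\<in>A. Poly_Mapping.single u (a (quot_class X S x y u)))"
  using assms
proof (induction A rule: finite_induct)
  case empty
  show ?case by (simp add: Q.lincomb_def zero_Q)
next
  case (insert u A)
  let ?q = "quot_class X S x y"
  have "?q u \<notin> ?q ` A" using insert by auto
  moreover have "(\<lambda>v. a v \<odot>\<^bsub>Q\<^esub> v) \<in> ?q ` A \<rightarrow> carrier Q"
    using insert.prems(1) quot_class_carrier by (auto intro!: Q.smult_closed)
  moreover have "a (?q u) \<odot>\<^bsub>Q\<^esub> ?q u \<in> carrier Q"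
    using insert.prems(1) quot_class_carrier by (auto intro!: Q.smult_closed)
  ultimately have "Q.lincomb a (?q ` insert u A) = a (?q u) \<odot>\<^bsub>Q\<^esub> ?q u \<oplus>\<^bsub>Q\<^esub> Q.lincomb a (?q ` A)"
    unfolding Q.lincomb_def using insert.hyps(1) by (simp add: Q.M.finsum_insert)
  also have "a (?q u) \<odot>\<^bsub>Q\<^esub> ?q u = residue (Poly_Mapping.single u (a (?q u)))"
    unfolding quot_class_residue[of u] smult_Q by (simp add: pword_def)
  finally show ?case using insert by (simp add: add_Q)
qed

lemma residue_lincomb:
  assumes "Poly_Mapping.keys p \<subseteq> hom_set X x y" "inj_on (quot_class X S x y) (Poly_Mapping.keys p)"
  obtains a where "Q.lincomb a (quot_class X S x y ` Poly_Mapping.keys p) = residue p"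
    "\<And>u. u \<in> Poly_Mapping.keys p \<Longrightarrow> a (quot_class X S x y u) = Poly_Mapping.lookup p u"
proof -
  let ?q = "quot_class X S x y"
  \<comment> \<open>Coefficients are transported from words to classes through the inverse of the
    injective class map.\<close>
  define a where "a = (\<lambda>v. Poly_Mapping.lookup p (inv_into (Poly_Mapping.keys p) ?q v))"
  have a: "a (?q u) = Poly_Mapping.lookup p u" if "u \<in> Poly_Mapping.keys p" for u
    using that assms(2) by (simp add: a_def)
  then have "(\<Sum>u\<in>Poly_Mapping.keys p. Poly_Mapping.single u (a (?q u))) = p"
    using sum_single_lookup[of p] by simp
  then show thesis using that a lincomb_quot_class[OF finite_keys assms, of a] by simp
qed

text \<open>Lifts the basis property to polynomials: the first condition expresses linear
  independence together with distinctness of the classes, the second that the classes span.\<close>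

lemma basis_quot_class_iff:
  assumes B: "B \<subseteq> hom_set X x y"
  shows "inj_on (quot_class X S x y) B \<and> Q.basis (quot_class X S x y ` B) \<longleftrightarrow>
    (\<forall>p\<in>N. Poly_Mapping.keys p \<subseteq> B \<longrightarrow> p = 0) \<and>
    (\<forall>f\<in>hom_space X x y. \<exists>p. Poly_Mapping.keys p \<subseteq> B \<and> f - p \<in> N)"
    (is "?L \<longleftrightarrow> ?indep \<and> ?gen")
proof
  let ?q = "quot_class X S x y"
  assume ?L
  then have inj: "inj_on ?q B" and indep: "Q.lin_indpt (?q ` B)" and span: "Q.span (?q ` B) = carrier Q"
    by (auto simp: Q.basis_def)
  have ?indep
  proof (intro ballI impI, rule ccontr)
    fix p assume p: "p \<in> N" "Poly_Mapping.keys p \<subseteq> B" "p \<noteq> 0"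
    then obtain a where a: "Q.lincomb a (?q ` Poly_Mapping.keys p) = residue p"
        "\<And>u. u \<in> Poly_Mapping.keys p \<Longrightarrow> a (?q u) = Poly_Mapping.lookup p u"
      using residue_lincomb[of p] B inj_on_subset[OF inj] by (metis subset_trans)
    obtain u where u: "u \<in> Poly_Mapping.keys p" using p(3) by (metis keys_eq_empty ex_in_conv)
    \<comment> \<open>A nonzero \<open>p\<close> in the ideal, read modulo the ideal, is a
      nontrivial relation between the classes of its words.\<close>
    have "Q.lin_dep (?q ` B)"
    proof (rule Q.lin_dep_crit)
      show "Q.lincomb a (?q ` Poly_Mapping.keys p) = \<zero>\<^bsub>Q\<^esub>"
        using a(1) p(1) by (simp add: zero_Q residue_eq_iff)
      show "a (?q u) \<noteq> \<zero>\<^bsub>class_ring\<^esub>" using a(2)[OF u] u by (simp add: in_keys_iff)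
    qed (use u p(2) in auto)
    then show False using indep by simp
  qed
  moreover have ?gen
  proof
    fix f :: "('a, 'b, 'k) cpoly"
    assume "f \<in> hom_space X x y"
    then have "residue f \<in> Q.span (?q ` B)" unfolding span carrier_Q by simp
    then obtain a A' where "residue f = Q.lincomb a A'" "finite A'" "A' \<subseteq> ?q ` B"
      unfolding Q.span_def by blast
    \<comment> \<open>A finite set of classes is lifted to a finite set of words, so that the
      combination becomes the residue of a polynomial supported on \<open>B\<close>.\<close>
    moreover from this obtain A where "A \<subseteq> B" "finite A" "A' = ?q ` A"
      using finite_subset_image by metis
    ultimately have A: "A \<subseteq> B" "residue f = residue (\<Sum>u\<in>A. Poly_Mapping.single u (a (?q u)))"
      using lincomb_quot_class[of A a] B inj_on_subset[OF inj] by auto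
    then show "\<exists>p. Poly_Mapping.keys p \<subseteq> B \<and> f - p \<in> N"
      using keys_sum_single[of "\<lambda>u. u" "\<lambda>u. a (?q u)" A] unfolding residue_eq_iff
      by (intro exI[of _ "\<Sum>u\<in>A. Poly_Mapping.single u (a (?q u))"]) auto
  qed
  ultimately show "?indep \<and> ?gen" by blast
next
  let ?q = "quot_class X S x y"
  assume "?indep \<and> ?gen"
  then have indep: "\<And>p. p \<in> N \<Longrightarrow> Poly_Mapping.keys p \<subseteq> B \<Longrightarrow> p = 0" and gen: ?gen by blast+
  have inj: "inj_on ?q B"
  proof (rule inj_onI)
    fix u v assume uv: "u \<in> B" "v \<in> B" "?q u = ?q v"
    \<comment> \<open>If two classes coincide, the difference of the words is an ideal element
      supported on \<open>B\<close>, hence 0.\<close>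
    have "Poly_Mapping.keys (pword u - pword v :: ('a, 'b, 'k) cpoly) \<subseteq> B"
      using uv(1,2) by (auto simp: in_keys_iff lookup_minus pword_def lookup_single when_def
          split: if_splits)
    then have "pword u = (pword v :: ('a, 'b, 'k) cpoly)"
      using uv(3) indep[of "pword u - pword v"] by (simp add: quot_class_residue residue_eq_iff)
    then have "Poly_Mapping.keys (pword u :: ('a, 'b, 'k) cpoly) =
        Poly_Mapping.keys (pword v :: ('a, 'b, 'k) cpoly)" by simp
    then show "u = v" by (simp add: pword_def)
  qed
  have lincomb: "Q.lincomb a A' = residue p \<and> Poly_Mapping.keys p \<subseteq> B"
    if "A \<subseteq> B" "finite A" "A' = ?q ` A" "p = (\<Sum>u\<in>A. Poly_Mapping.single u (a (?q u)))"
    for a A A' p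
    using lincomb_quot_class[of A a] B inj_on_subset[OF inj] that
      keys_sum_single[of "\<lambda>u. u" "\<lambda>u. a (?q u)" A] by auto
  have "Q.lin_indpt (?q ` B)"
  proof
    assume "Q.lin_dep (?q ` B)"
    then obtain a A' v where A': "finite A'" "A' \<subseteq> ?q ` B" "Q.lincomb a A' = \<zero>\<^bsub>Q\<^esub>" "v \<in> A'" "a v \<noteq> 0"
      unfolding Q.lin_dep_def by auto
    obtain A where A: "A \<subseteq> B" "finite A" "A' = ?q ` A" using finite_subset_image[OF A'(1,2)] by auto
    define p where "p = (\<Sum>u\<in>A. Poly_Mapping.single u (a (?q u)))"
    have "p \<in> N" "Poly_Mapping.keys p \<subseteq> B"
      using lincomb[OF A p_def] A'(3) residue_eq_iff[of p 0] by (simp_all add: zero_Q)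
    then have "p = 0" by (rule indep)
    moreover obtain u where "u \<in> A" "v = ?q u" using A'(4) A(3) by auto
    ultimately show False using lookup_sum_single[OF A(2), of "\<lambda>u. a (?q u)" u] A'(5) by (simp add: p_def)
  qed
  moreover have carrier: "?q ` B \<subseteq> carrier Q" using B quot_class_carrier by auto
  moreover have "Q.span (?q ` B) = carrier Q"
  proof
    show "Q.span (?q ` B) \<subseteq> carrier Q" using Q.span_is_subset2[OF carrier] .
    show "carrier Q \<subseteq> Q.span (?q ` B)"
    proof
      fix F assume "F \<in> carrier Q"
      then obtain f where f: "f \<in> hom_space X x y" "F = residue f" by (auto simp: carrier_Q)
      then obtain p where p: "Poly_Mapping.keys p \<subseteq> B" "f - p \<in> N" using gen by blast
      obtain a where "Q.lincomb a (?q ` Poly_Mapping.keys p) = residue p"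
        using residue_lincomb[of p] p(1) B inj_on_subset[OF inj] by (metis subset_trans)
      moreover have "residue p = F" using f(2) p(2) by (simp add: residue_eq_iff[symmetric])
      ultimately show "F \<in> Q.span (?q ` B)"
        unfolding Q.span_def using p(1)
        by (intro CollectI exI[of _ a] exI[of _ "?q ` Poly_Mapping.keys p"]) auto
    qed
  qed
  ultimately show ?L using inj by (simp add: Q.basis_def)
qed

end


section \<open>The equivalences\<close>

context monic_relations
begin

lemma S_word_verts:
  assumes "(a, s, b) \<in> S_words X S x y"
  shows "x \<in> verts X" "y \<in> verts X"
  using assms src_in_verts[of a] tgt_in_verts[of b] by (auto simp: S_words_iff)

lemma Id_gen_lead_words:
  assumes "f \<in> Id_gen X S" "f \<noteq> 0"
  shows "lead r f \<in> words X"
  using assms lead_in_hom_set[OF S_span_hom_space] unfolding Id_gen_iff by (auto simp: hom_set_def)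

text \<open>The remainder of an ideal element is again in the ideal. Were it nonzero, its leading
  word would be reducible by \<open>red\<close> and irreducible by division.\<close>

lemma standard_representation:
  assumes red: "\<forall>f\<in>Id_gen X S. f \<noteq> 0 \<longrightarrow> lead r f \<notin> Irr X r S"
    and verts: "x \<in> verts X" "y \<in> verts X" and f: "f \<in> S_span x y (\<lambda>_. True)" "f \<noteq> 0"
  obtains ts where "\<And>t. t \<in> set ts \<Longrightarrow> snd t \<in> S_words X S x y \<and> (term_lead r t, lead r f) \<in> r"
    "sorted_wrt (\<lambda>t t'. wless r (term_lead r t') (term_lead r t)) ts" "f = comb_value ts"
proof -
  obtain ts p where ts: "\<forall>t\<in>set ts. snd t \<in> S_words X S x y \<and> (term_lead r t, lead r f) \<in> r"
      "sorted_wrt (\<lambda>t t'. wless r (term_lead r t') (term_lead r t)) ts" "f = comb_value ts + p"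
      "Poly_Mapping.keys p \<subseteq> Irr X r S"
    using division[OF S_span_hom_space[OF f(1)] f(2)] by blast
  have "comb_value ts \<in> S_span x y (\<lambda>_. True)" using ts(1) unfolding S_span_def by blast
  then have "f - comb_value ts \<in> S_span x y (\<lambda>_. True)" using f(1) by (intro S_span_diff)
  then have p: "p \<in> S_span x y (\<lambda>_. True)" using ts(3) by simp
  have "p = 0"
  proof (rule ccontr)
    assume "p \<noteq> 0"
    then have "lead r p \<notin> Irr X r S" using red p verts Id_gen_iff by blast
    then show False
      using lead_in_keys[OF \<open>p \<noteq> 0\<close> hom_space_words[OF S_span_hom_space[OF p]]] ts(4) by blast
  qed
  then show thesis using ts(1-3) by (intro that[of ts]) auto
qed

text \<open>Both \<open>S\<close>-words are monic with leading word \<open>w\<close>, so their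
  difference has a smaller leading word. A standard representation of it uses only terms up to that
  word, hence below \<open>w\<close>.\<close>

lemma reducible_critical_pair:
  assumes red: "\<forall>f\<in>Id_gen X S. f \<noteq> 0 \<longrightarrow> lead r f \<notin> Irr X r S"
    and 1: "(a, f, b) \<in> S_words X S x y" "a \<bullet>\<^sub>w lead r f \<bullet>\<^sub>w b = w"
    and 2: "(a', g, b') \<in> S_words X S x y" "a' \<bullet>\<^sub>w lead r g \<bullet>\<^sub>w b' = w"
  shows "equiv_mod X r S w (pword a \<bullet>\<^sub>p f \<bullet>\<^sub>p pword b - pword a' \<bullet>\<^sub>p g \<bullet>\<^sub>p pword b') 0"
proof -
  let ?V = "pword a \<bullet>\<^sub>p f \<bullet>\<^sub>p pword b" and ?V' = "pword a' \<bullet>\<^sub>p g \<bullet>\<^sub>p pword b'"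
  note V = S_word_value[OF 1(1), unfolded 1(2)] and V' = S_word_value[OF 2(1), unfolded 2(2)]
  have span: "?V - ?V' \<in> S_span x y (\<lambda>_. True)"
    using S_word_in_S_span[OF 1(1), of "\<lambda>_. True" 1] S_word_in_S_span[OF 2(1), of "\<lambda>_. True" 1]
    by (simp add: pscale_simps S_span_diff)
  have "?V - ?V' \<in> S_span x y (\<lambda>u. wless r u w)"
  proof (cases "?V - ?V' = 0")
    case True
    then show ?thesis by (simp add: S_span_0)
  next
    case False
    have "lead r (?V - ?V') \<in> Poly_Mapping.keys (?V - ?V')"
      using lead_in_keys[OF False hom_space_words[OF S_span_hom_space[OF span]]] .
    then have less: "wless r (lead r (?V - ?V')) w"
      using cancel_lead[OF V(1,4) V'(1,4)] V(2,3) V'(2,3) by simp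
    obtain ts where "\<And>t. t \<in> set ts \<Longrightarrow>
          snd t \<in> S_words X S x y \<and> (term_lead r t, lead r (?V - ?V')) \<in> r"
        "?V - ?V' = comb_value ts"
      using standard_representation[OF red S_word_verts[OF 1(1)] span False] by metis
    then show ?thesis using le_wless_trans[OF _ less] unfolding S_span_def by blast
  qed
  then show ?thesis by (rule S_span_equiv_mod[OF S_word_verts[OF 1(1)]])
qed

text \<open>For the converse direction, every composition is a difference of two
  \<open>S\<close>-words with leading word \<open>w\<close>, to which
  \<open>reducible_critical_pair\<close> applies.\<close>

lemma GS_basis_iff_reducible:
  "GS_basis X r S \<longleftrightarrow> (\<forall>f\<in>Id_gen X S. f \<noteq> 0 \<longrightarrow> lead r f \<notin> Irr X r S)"
proof
  assume "GS_basis X r S"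
  then show "\<forall>f\<in>Id_gen X S. f \<noteq> 0 \<longrightarrow> lead r f \<notin> Irr X r S"
    using GS_basis_lead_reducible Id_gen_iff by blast
next
  assume red: "\<forall>f\<in>Id_gen X S. f \<noteq> 0 \<longrightarrow> lead r f \<notin> Irr X r S"
  show "GS_basis X r S"
    unfolding GS_basis_def
  proof (intro ballI, clarify)
    fix f g w h assume fg: "f \<in> S" "g \<in> S"
      and h: "(w, h) \<in> inclusion_comps X r f g \<union> intersection_comps X r f g"
    note f = relation_properties[OF fg(1)] and g = relation_properties[OF fg(2)]
    \<comment> \<open>Identity words serve as the missing outer factors, turning \<open>f\<close>,
      \<open>f b\<close> and \<open>a g\<close> into \<open>S\<close>-words.\<close>
    let ?l = "(src (lead r f), [], src (lead r f))" and ?l' = "(tgt (lead r f), [], tgt (lead r f))"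
      and ?e = "(tgt (lead r g), [], tgt (lead r g))"
    have units: "?l \<in> words X" "?l' \<in> words X" "?e \<in> words X"
      using f(3) g(3) by (simp_all add: words_def awalk_Nil_iff src_in_verts tgt_in_verts)
    have ends: "src (v, [], v) = v" "tgt (v, [], v) = v" "path_arcs (v, [], v) = []"
      for v :: 'a
      by (simp_all add: src_def tgt_def path_arcs_def)
    from h consider
        (incl) a b where "a \<in> words X" "b \<in> words X" "tgt a = src (lead r g)" "tgt (lead r g) = src b"
          "w = lead r f" "w = a \<bullet>\<^sub>w lead r g \<bullet>\<^sub>w b" "h = f - pword a \<bullet>\<^sub>p g \<bullet>\<^sub>p pword b"
      | (inter) a b where "a \<in> words X" "b \<in> words X" "tgt (lead r f) = src b" "tgt a = src (lead r g)"
          "w = lead r f \<bullet>\<^sub>w b" "w = a \<bullet>\<^sub>w lead r g" "h = f \<bullet>\<^sub>p pword b - pword a \<bullet>\<^sub>p g"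
      unfolding inclusion_comps_def intersection_comps_def composable_def by blast
    then show "equiv_mod X r S w h 0"
    proof cases
      case incl
      have st: "src (lead r f) = src a" "tgt (lead r f) = tgt b"
        using incl(5,6) src_wcomp tgt_wcomp by metis+
      have "(?l, f, ?l') \<in> S_words X S (src a) (tgt b)" "(a, g, b) \<in> S_words X S (src a) (tgt b)"
        using incl(1-4) fg units st by (simp_all add: S_words_iff ends)
      moreover have "?l \<bullet>\<^sub>w lead r f \<bullet>\<^sub>w ?l' = w"
        unfolding incl(5) word_eq_iff[of _ "lead r f"] by (simp add: ends)
      ultimately have "equiv_mod X r S w
          (pword ?l \<bullet>\<^sub>p f \<bullet>\<^sub>p pword ?l' - pword a \<bullet>\<^sub>p g \<bullet>\<^sub>p pword b) 0"
        using reducible_critical_pair[OF red] incl(6)[symmetric] by blast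
      then show ?thesis unfolding unit_pmult[OF f(4)] pmult_unit[OF f(4)] incl(7) .
    next
      case inter
      have st: "src (lead r f) = src a" "tgt b = tgt (lead r g)"
        using inter(5,6) src_wcomp tgt_wcomp by metis+
      have "(?l, f, b) \<in> S_words X S (src a) (tgt b)" "(a, g, ?e) \<in> S_words X S (src a) (tgt b)"
        using inter(1-4) fg units st by (simp_all add: S_words_iff ends)
      moreover have "?l \<bullet>\<^sub>w lead r f \<bullet>\<^sub>w b = w"
        unfolding inter(5) word_eq_iff[of _ "lead r f \<bullet>\<^sub>w b"] by (simp add: ends)
      moreover have "a \<bullet>\<^sub>w lead r g \<bullet>\<^sub>w ?e = w"
        unfolding inter(6) word_eq_iff[of _ "a \<bullet>\<^sub>w lead r g"] by (simp add: ends)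
      ultimately have "equiv_mod X r S w
          (pword ?l \<bullet>\<^sub>p f \<bullet>\<^sub>p pword b - pword a \<bullet>\<^sub>p g \<bullet>\<^sub>p pword ?e) 0"
        using reducible_critical_pair[OF red] by blast
      moreover have "pword a \<bullet>\<^sub>p g \<in> hom_space X (src a) (tgt (lead r g))"
        using pmult_hom_space[OF wf_digraph_axioms pword_hom_space[OF inter(1)]] g(4) inter(4)
        by metis
      ultimately show ?thesis unfolding inter(7) by (simp add: unit_pmult[OF f(4)] pmult_unit)
    qed
  qed
qed

text \<open>The leading word of the sum is that of the first term with nonzero coefficient. Zero
  coefficients are allowed, so the induction skips such terms.\<close>

lemma sorted_comb_lead_reducible:
  assumes "\<forall>t\<in>set ts. snd t \<in> S_words X S x y"
    "sorted_wrt (\<lambda>t t'. wless r (term_lead r t') (term_lead r t)) ts" "comb_value ts \<noteq> 0"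
  shows "lead r (comb_value ts) \<notin> Irr X r S"
  using assms
proof (induction ts)
  case (Cons t ts)
  obtain \<alpha> a s b where t: "t = (\<alpha>, a, s, b)" by (cases t)
  show ?case
  proof (cases "\<alpha> = 0")
    case True
    then show ?thesis using Cons by (simp add: t)
  next
    case False
    have S: "(a, s, b) \<in> S_words X S x y" using Cons.prems by (simp add: t)
    have "comb_value ts \<in> S_span x y (\<lambda>u. wless r u (a \<bullet>\<^sub>w lead r s \<bullet>\<^sub>w b))"
      using Cons.prems unfolding S_span_def by (auto simp: t)
    then have "lead r (comb_value (t # ts)) = a \<bullet>\<^sub>w lead r s \<bullet>\<^sub>w b"
      using lead_top_term[OF S refl False, of "comb_value (t # ts)"] by (simp add: t)
    then show ?thesis using S_word_reducible[OF S] by simp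
  qed
qed simp

text \<open>Forward, division leaves no remainder. Backward, strict sorting prevents cancellation of
  the first nonzero term. The element 0 is the empty combination.\<close>

lemma reducible_iff_sorted_representation:
  "(\<forall>f\<in>Id_gen X S. f \<noteq> 0 \<longrightarrow> lead r f \<notin> Irr X r S) \<longleftrightarrow>
    (\<forall>f\<in>Id_gen X S. \<exists>ts\<in>S_combs X S. f = comb_value ts \<and>
       sorted_wrt (\<lambda>t t'. wless r (term_lead r t') (term_lead r t)) ts)"
proof
  assume red: "\<forall>f\<in>Id_gen X S. f \<noteq> 0 \<longrightarrow> lead r f \<notin> Irr X r S"
  show "\<forall>f\<in>Id_gen X S. \<exists>ts\<in>S_combs X S. f = comb_value ts \<and>
    sorted_wrt (\<lambda>t t'. wless r (term_lead r t') (term_lead r t)) ts"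
  proof
    fix f assume "f \<in> Id_gen X S"
    then obtain x y where xy: "x \<in> verts X" "y \<in> verts X" "f \<in> S_span x y (\<lambda>_. True)"
      unfolding Id_gen_iff by blast
    show "\<exists>ts\<in>S_combs X S. f = comb_value ts \<and>
      sorted_wrt (\<lambda>t t'. wless r (term_lead r t') (term_lead r t)) ts"
    proof (cases "f = 0")
      case True
      have "[] \<in> S_combs X S" using xy unfolding S_combs_iff by auto
      then show ?thesis using True by (intro bexI[of _ "[]"]) simp_all
    next
      case False
      then show ?thesis
        using standard_representation[OF red xy] xy(1,2) unfolding Bex_def S_combs_iff by metis
    qed
  qed
next
  assume rep: "\<forall>f\<in>Id_gen X S. \<exists>ts\<in>S_combs X S. f = comb_value ts \<and>
    sorted_wrt (\<lambda>t t'. wless r (term_lead r t') (term_lead r t)) ts"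
  show "\<forall>f\<in>Id_gen X S. f \<noteq> 0 \<longrightarrow> lead r f \<notin> Irr X r S"
  proof (intro ballI impI)
    fix f assume "f \<in> Id_gen X S" "f \<noteq> 0"
    then obtain ts where ts: "ts \<in> S_combs X S" "f = comb_value ts"
        "sorted_wrt (\<lambda>t t'. wless r (term_lead r t') (term_lead r t)) ts"
      using rep by blast
    obtain x y where "\<forall>t\<in>set ts. snd t \<in> S_words X S x y" using ts(1) unfolding S_combs_iff by blast
    then show "lead r f \<notin> Irr X r S"
      using sorted_comb_lead_reducible ts(2,3) \<open>f \<noteq> 0\<close> by blast
  qed
qed

text \<open>Division always provides the spanning half, so being a basis amounts to the absence of
  nonzero ideal elements supported on irreducible words.\<close>

lemma reducible_iff_linear_basis:
  "(\<forall>f\<in>Id_gen X S. f \<noteq> 0 \<longrightarrow> lead r f \<notin> Irr X r S) \<longleftrightarrow> linear_basis X S (Irr X r S)"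
proof -
  have linear_basis: "linear_basis X S (Irr X r S) \<longleftrightarrow> (\<forall>x\<in>verts X. \<forall>y\<in>verts X.
    (\<forall>p\<in>hom_ideal X S x y. Poly_Mapping.keys p \<subseteq> Irr X r S \<inter> hom_set X x y \<longrightarrow> p = 0) \<and>
    (\<forall>f\<in>hom_space X x y. \<exists>p. Poly_Mapping.keys p \<subseteq> Irr X r S \<inter> hom_set X x y \<and>
       f - p \<in> hom_ideal X S x y))"
    unfolding linear_basis_def
    by (intro ball_cong refl quotient_hom_space.basis_quot_class_iff quotient_hom_space.intro
        quotient_hom_space_axioms.intro wf_digraph_axioms) auto
  show ?thesis
  proof
    assume red: "\<forall>f\<in>Id_gen X S. f \<noteq> 0 \<longrightarrow> lead r f \<notin> Irr X r S"
    show "linear_basis X S (Irr X r S)"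
      unfolding linear_basis
    proof (intro ballI conjI impI)
      fix x y p assume p: "p \<in> hom_ideal X S x y" "Poly_Mapping.keys p \<subseteq> Irr X r S \<inter> hom_set X x y"
      then have "p \<in> Id_gen X S" "p \<in> hom_space X x y" by (auto simp: hom_ideal_def)
      then show "p = 0" using red lead_in_keys[OF _ hom_space_words] p(2) by blast
    next
      fix x y and f :: "('a, 'b, 'k) cpoly"
      assume xy: "x \<in> verts X" "y \<in> verts X" and f: "f \<in> hom_space X x y"
      show "\<exists>p. Poly_Mapping.keys p \<subseteq> Irr X r S \<inter> hom_set X x y \<and> f - p \<in> hom_ideal X S x y"
      proof (cases "f = 0")
        case True
        then show ?thesis
          using hom_ideal_closed(1)[OF wf_digraph_axioms xy] by (intro exI[of _ 0]) simp
      next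
        case False
        then obtain ts p where ts: "\<forall>t\<in>set ts. snd t \<in> S_words X S x y" "f = comb_value ts + p"
            "Poly_Mapping.keys p \<subseteq> Irr X r S"
          using division[OF f] by blast
        have span: "comb_value ts \<in> S_span x y (\<lambda>_. True)" using ts(1) unfolding S_span_def by blast
        have "p = f - comb_value ts" using ts(2) by simp
        then have "p \<in> hom_space X x y" using hom_space_closed(3)[OF f S_span_hom_space[OF span]] by simp
        then have "Poly_Mapping.keys p \<subseteq> hom_set X x y" by (simp add: hom_space_def)
        moreover have "f - p \<in> hom_ideal X S x y"
          using span ts(2) by (simp add: hom_ideal_eq_S_span[OF xy])
        ultimately show ?thesis using ts(3) by blast
      qed
    qed
  next
    assume basis: "linear_basis X S (Irr X r S)"
    show "\<forall>f\<in>Id_gen X S. f \<noteq> 0 \<longrightarrow> lead r f \<notin> Irr X r S"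
    proof (intro ballI impI notI)
      fix f assume "f \<in> Id_gen X S" and f: "f \<noteq> 0" "lead r f \<in> Irr X r S"
      then obtain x y where xy: "x \<in> verts X" "y \<in> verts X" "f \<in> S_span x y (\<lambda>_. True)"
        unfolding Id_gen_iff by blast
      \<comment> \<open>The irreducible leading word of \<open>f\<close> forces \<open>p\<close> to
        be nonzero. This remainder is then an ideal element on irreducible words, against
        independence.\<close>
      obtain ts p where ts: "\<forall>t\<in>set ts. snd t \<in> S_words X S x y" "f = comb_value ts + p"
          "Poly_Mapping.keys p \<subseteq> Irr X r S" "p \<noteq> 0"
        using division[OF S_span_hom_space[OF xy(3)] f(1)] f(2) by blast
      have span: "comb_value ts \<in> S_span x y (\<lambda>_. True)" using ts(1) unfolding S_span_def by blast
      have "p = f - comb_value ts" using ts(2) by simp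
      then have "p \<in> S_span x y (\<lambda>_. True)" using S_span_diff[OF xy(3) span] by simp
      then have "p \<in> hom_ideal X S x y" "Poly_Mapping.keys p \<subseteq> hom_set X x y"
        using hom_ideal_eq_S_span[OF xy(1,2)] S_span_hom_space by (auto simp: hom_space_def)
      then show False using basis ts(3,4) xy(1,2) unfolding linear_basis by blast
    qed
  qed
qed

end

theorem theorem4p4:
  fixes X :: "('a, 'b) pre_digraph"
    and r :: "('a, 'b) word rel"
    and S :: "('a, 'b, 'k::field) cpoly set"
  assumes "wf_digraph X"
    and "monomial_order X r"
    and "S \<subseteq> kC X" and "S \<noteq> {}" and "\<forall>s\<in>S. is_monic r s"
  shows
    "(GS_basis X r S \<longleftrightarrow>
       (\<forall>f\<in>Id_gen X S. f \<noteq> 0 \<longrightarrow>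
          (\<exists>s\<in>S. \<exists>a\<in>words X. \<exists>b\<in>words X.
             composable a (lead r s) \<and> composable (lead r s) b \<and>
             lead r f = a \<bullet>\<^sub>w lead r s \<bullet>\<^sub>w b))) \<and>
     (GS_basis X r S \<longleftrightarrow>
       (\<forall>f\<in>Id_gen X S. \<exists>ts\<in>S_combs X S. f = comb_value ts \<and>
          sorted_wrt (\<lambda>t t'. wless r (term_lead r t') (term_lead r t)) ts)) \<and>
     (GS_basis X r S \<longleftrightarrow> linear_basis X S (Irr X r S))"
proof -
  interpret monic_relations X r S
    using assms by (intro monic_relations.intro monomial_category.intro monomial_category_axioms.intro
        monic_relations_axioms.intro)
  \<comment> \<open>\<open>reducible_iff\<close> turns non-membership in \<open>Irr X r S\<close>
    into a factorization; \<open>Id_gen_lead_words\<close> supplies its premise.\<close>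
  have "GS_basis X r S \<longleftrightarrow>
       (\<forall>f\<in>Id_gen X S. f \<noteq> 0 \<longrightarrow>
          (\<exists>s\<in>S. \<exists>a\<in>words X. \<exists>b\<in>words X.
             composable a (lead r s) \<and> composable (lead r s) b \<and>
             lead r f = a \<bullet>\<^sub>w lead r s \<bullet>\<^sub>w b))"
    using GS_basis_iff_reducible reducible_iff[OF Id_gen_lead_words] by blast
  then show ?thesis
    using GS_basis_iff_reducible reducible_iff_sorted_representation reducible_iff_linear_basis
    by simp
qed

end
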